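(* Let $(\nabla,h)$ be a special statistical structure with cubic form $L$ and scalar curvature $r$ on a manifold of dimension $n\geq2$. (1) $(\nabla,h)$ has constant curvature if and only if $(h,L)$ solves the coupled projectively flat equations with constants $c=\frac14$ and $\kappa=r$. (2) $(\nabla,h)$ has self-conjugate curvature and is Einstein if and only if $(h,L)$ solves the coupled Einstein equations with constants $c=\frac14$ and $\kappa=r$. (3) $(\nabla,h)$ has self-conjugate curvature and constant scalar curvature if and only if $(h,L)$ solves the coupled constraint equations with constants $c=\frac14$ and $\kappa=r$. (In each case the assertion that $\kappa = r$ is a constant is part of the statement that the equations are solved.)
   Context: The curvature of a torsion-free connection $\nabla$ is defined by $\nabla_i\nabla_j\alpha_k-\nabla_j\nabla_i\alpha_k=-R_{ijk}{}^p\alpha_p$ for one-forms $\alpha$. Given a pseudo-Riemannian metric $h$, $R_{ijkl}=R_{ijk}{}^ph_{pl}$, $\rho(R)_{ij}=R_{pij}{}^p$. For the Levi-Civita connection $D$ of $h$ these are denoted $\mathrm{Riem}$, $\mathrm{Ric}$, with $\mathrm{scal}=h^{ij}\mathrm{Ric}_{ij}$. A statistical structure $(\nabla,h)$ is a pseudo-Riemannian metric $h$ and a torsion-free affine connection $\nabla$ with $\nabla_ih_{jk}=\nabla_jh_{ik}$. Its cubic form is the completely symmetric tensor $L_{ijk}=\nabla_ih_{jk}$. The conjugate statistical structure is $(\bar\nabla,h)$ with $\bar\nabla=\nabla+h^{kp}\nabla_ih_{jp}$; its cubic form is $-L$. The structure is special if $\nabla\det h=0$, equivalently $h^{jk}L_{ijk}=0$.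 Let $R$ and $\bar R$ be the curvatures of $\nabla$ and $\bar\nabla$. The scalar curvature of $(\nabla,h)$ is $r=h^{ij}\rho(R)_{ij}$ (which equals $h^{ij}\rho(\bar R)_{ij}$). It has self-conjugate curvature if $R_{ijk}{}^l=\bar R_{ijk}{}^l$. A special statistical structure is Einstein if $\rho(R)$ and $\rho(\bar R)$ are (pointwise) multiples of $h$ and $r$ is constant. It has constant curvature if $R_{ijkl}=\alpha\,(h\circledast h)_{ijkl}$ for a constant $\alpha\in\mathbb{R}$, where $(h\circledast h)_{ijkl}=h_{ki}h_{jl}-h_{kj}h_{il}$. For $\omega\in\Gamma(S^3(T^*M))$, $(\omega\circledast\omega)_{ijkl}=\omega_{ki}{}^a\omega_{jla}-\omega_{kj}{}^a\omega_{ila}$; if $\omega$ is trace-free, $\rho(\omega\circledast\omega)_{ij}=\omega_{iab}\omega_j{}^{ab}$. $|\omega|^2=\omega^{ijk}\omega_{ijk}$. Each of the following systems for a pair $(h,\omega)$, with $\omega$ an $h$-trace-free symmetric 3-tensor and constants $c,\kappa\in\mathbb{R}$, includes the requirement that $\omega$ be Codazzi, $D_i\omega_{jkl}=D_j\omega_{ikl}$ (equivalently, that $\omega$ be divergence free and the trace-free part of $D_{[i}\omega_{j]kl}$ vanish): - Coupled projectively flat equations: $\mathrm{Riem}-c(\omega\circledast\omega)=-\frac{\kappa}{n(n-1)}h\circledast h$. - Coupled Einstein equations: $\mathrm{Ric}-\frac12\mathrm{scal}\,h+\frac{n-2}{2n}\kappa h=c\left(\rho(\omega\circledast\omega)-\frac12|\omega|^2h\right)$.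 - Coupled constraint equations: $D_i(\mathrm{scal}-c|\omega|^2)=0$, with $\kappa$ denoting the constant $\mathrm{scal}-c|\omega|^2$. *)

theory Defs
  imports "HOL-Analysis.Analysis"
begin

section \<open>Smooth functions on open subsets of Euclidean space\<close>

definition pd :: "'n::finite \<Rightarrow> (real^'n \<Rightarrow> real) \<Rightarrow> real^'n \<Rightarrow> real" where
  "pd i f x = frechet_derivative f (at x) (axis i 1)"

fun Ck_on :: "nat \<Rightarrow> (real^'n::finite) set \<Rightarrow> (real^'n \<Rightarrow> real) \<Rightarrow> bool" where
  "Ck_on 0 S f \<longleftrightarrow> continuous_on S f"
| "Ck_on (Suc k) S f \<longleftrightarrow> (\<forall>x\<in>S. f differentiable (at x)) \<and> (\<forall>i. Ck_on k S (pd i f))"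

definition smooth_on :: "(real^'n::finite) set \<Rightarrow> (real^'n \<Rightarrow> real) \<Rightarrow> bool" where
  "smooth_on S f \<longleftrightarrow> (\<forall>k. Ck_on k S f)"

section \<open>Smooth manifolds\<close>

text \<open>The manifold is the whole (Hausdorff, second countable) type \<open>'m\<close>. A chart is a pair
  of a domain and a coordinate map; the dimension is \<open>CARD('n)\<close>.\<close>

type_synonym ('m, 'n) chart = "'m set \<times> ('m \<Rightarrow> real^'n)"

definition coords :: "('m, 'n::finite) chart \<Rightarrow> (real^'n) set" where
  "coords c = snd c ` fst c"

definition overlap :: "('m, 'n::finite) chart \<Rightarrow> ('m, 'n) chart \<Rightarrow> (real^'n) set" where
  "overlap c d = snd c ` (fst c \<inter> fst d)"

definition transition :: "('m, 'n::finite) chart \<Rightarrow> ('m, 'n) chart \<Rightarrow> real^'n \<Rightarrow> real^'n" where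
  "transition c d x = snd d (inv_into (fst c) (snd c) x)"

definition smooth_atlas ::
    "('m::{t2_space,second_countable_topology}, 'n::finite) chart set \<Rightarrow> bool" where
  "smooth_atlas A \<longleftrightarrow>
     (\<forall>c\<in>A. open (fst c) \<and> open (coords c) \<and>
        homeomorphism (fst c) (coords c) (snd c) (inv_into (fst c) (snd c))) \<and>
     (\<Union>c\<in>A. fst c) = UNIV \<and>
     (\<forall>c\<in>A. \<forall>d\<in>A. \<forall>k. smooth_on (overlap c d) (\<lambda>x. transition c d x $ k))"

section \<open>Tensor calculus in coordinates\<close>

text \<open>Components of tensors and connections on a coordinate domain. Contravariant indices come
  last: \<open>\<Gamma> x i j k\<close> is \<open>\<Gamma>\<^sub>i\<^sub>j\<^sup>k\<close>, so \<open>\<nabla>\<^sub>i \<partial>\<^sub>j = \<Gamma>\<^sub>i\<^sub>j\<^sup>k \<partial>\<^sub>k\<close>, and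
  \<open>R x i j k l\<close> is \<open>R\<^sub>i\<^sub>j\<^sub>k\<^sup>l\<close> or \<open>R\<^sub>i\<^sub>j\<^sub>k\<^sub>l\<close>.\<close>

type_synonym 'n tensor1 = "real^'n \<Rightarrow> 'n \<Rightarrow> real"
type_synonym 'n tensor2 = "real^'n \<Rightarrow> 'n \<Rightarrow> 'n \<Rightarrow> real"
type_synonym 'n tensor3 = "real^'n \<Rightarrow> 'n \<Rightarrow> 'n \<Rightarrow> 'n \<Rightarrow> real"
type_synonym 'n tensor4 = "real^'n \<Rightarrow> 'n \<Rightarrow> 'n \<Rightarrow> 'n \<Rightarrow> 'n \<Rightarrow> real"

text \<open>In each of the following the first index after the point is the index of the covariant
  derivative, e.g. \<open>cov2 \<Gamma> \<beta> x i j k\<close> is \<open>\<nabla>\<^sub>i \<beta>\<^sub>j\<^sub>k\<close>.\<close>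

definition cov1 :: "'n::finite tensor3 \<Rightarrow> 'n tensor1 \<Rightarrow> 'n tensor2" where
  "cov1 \<Gamma> \<alpha> x i j = pd i (\<lambda>y. \<alpha> y j) x - (\<Sum>p\<in>UNIV. \<Gamma> x i j p * \<alpha> x p)"

definition cov2 :: "'n::finite tensor3 \<Rightarrow> 'n tensor2 \<Rightarrow> 'n tensor3" where
  "cov2 \<Gamma> \<beta> x i j k = pd i (\<lambda>y. \<beta> y j k) x
     - (\<Sum>p\<in>UNIV. \<Gamma> x i j p * \<beta> x p k) - (\<Sum>p\<in>UNIV. \<Gamma> x i k p * \<beta> x j p)"

definition cov3 :: "'n::finite tensor3 \<Rightarrow> 'n tensor3 \<Rightarrow> 'n tensor4" where
  "cov3 \<Gamma> \<omega> x i j k l = pd i (\<lambda>y. \<omega> y j k l) x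
     - (\<Sum>p\<in>UNIV. \<Gamma> x i j p * \<omega> x p k l) - (\<Sum>p\<in>UNIV. \<Gamma> x i k p * \<omega> x j p l)
     - (\<Sum>p\<in>UNIV. \<Gamma> x i l p * \<omega> x j k p)"

text \<open>Curvature is characterised by
  \<open>\<nabla>\<^sub>i\<nabla>\<^sub>j\<alpha>\<^sub>k - \<nabla>\<^sub>j\<nabla>\<^sub>i\<alpha>\<^sub>k = - R\<^sub>i\<^sub>j\<^sub>k\<^sup>p \<alpha>\<^sub>p\<close> for one-forms \<open>\<alpha>\<close>. Its components are read off
  from the coordinate one-forms \<open>\<alpha> = dx\<^sup>l\<close>; the identity for general \<open>\<alpha>\<close> is the lemma
  \<open>ricci_identity\<close> below.\<close>

definition coform :: "'n::finite \<Rightarrow> 'n tensor1" where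
  "coform l x k = (if k = l then 1 else 0)"

definition curvature :: "'n::finite tensor3 \<Rightarrow> 'n tensor4" where
  "curvature \<Gamma> x i j k l =
     - (cov2 \<Gamma> (cov1 \<Gamma> (coform l)) x i j k - cov2 \<Gamma> (cov1 \<Gamma> (coform l)) x j i k)"

definition rho :: "'n::finite tensor4 \<Rightarrow> 'n tensor2" where
  "rho R x i j = (\<Sum>p\<in>UNIV. R x p i j p)"

definition ginv :: "'n::finite tensor2 \<Rightarrow> 'n tensor2" where
  "ginv h x i j = matrix_inv (\<chi> i j. h x i j) $ i $ j"

definition lower_last :: "'n::finite tensor2 \<Rightarrow> 'n tensor4 \<Rightarrow> 'n tensor4" where
  "lower_last h R x i j k l = (\<Sum>p\<in>UNIV. R x i j k p * h x p l)"

definition raise_last :: "'n::finite tensor2 \<Rightarrow> 'n tensor4 \<Rightarrow> 'n tensor4" where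
  "raise_last h R x i j k l = (\<Sum>p\<in>UNIV. R x i j k p * ginv h x p l)"

definition trace_h :: "'n::finite tensor2 \<Rightarrow> 'n tensor2 \<Rightarrow> real^'n \<Rightarrow> real" where
  "trace_h h \<beta> x = (\<Sum>i\<in>UNIV. \<Sum>j\<in>UNIV. ginv h x i j * \<beta> x i j)"

text \<open>By lemma \<open>levi_civita_iff\<close> below these are the only torsion-free coefficients with
  \<open>D h = 0\<close>.\<close>

definition levi_civita :: "'n::finite tensor2 \<Rightarrow> 'n tensor3" where
  "levi_civita h x i j k = (\<Sum>l\<in>UNIV. ginv h x k l *
     (pd i (\<lambda>y. h y j l) x + pd j (\<lambda>y. h y i l) x - pd l (\<lambda>y. h y i j) x)) / 2"

definition Riem :: "'n::finite tensor2 \<Rightarrow> 'n tensor4" where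
  "Riem h = lower_last h (curvature (levi_civita h))"

definition Ric :: "'n::finite tensor2 \<Rightarrow> 'n tensor2" where
  "Ric h = rho (curvature (levi_civita h))"

definition scal :: "'n::finite tensor2 \<Rightarrow> real^'n \<Rightarrow> real" where
  "scal h = trace_h h (Ric h)"

text \<open>\<open>(h \<circledast> h)\<^sub>i\<^sub>j\<^sub>k\<^sub>l\<close> and \<open>(\<omega> \<circledast> \<omega>)\<^sub>i\<^sub>j\<^sub>k\<^sub>l\<close>.\<close>

definition kn2 :: "'n::finite tensor2 \<Rightarrow> 'n tensor4" where
  "kn2 h x i j k l = h x k i * h x j l - h x k j * h x i l"

definition kn3 :: "'n::finite tensor2 \<Rightarrow> 'n tensor3 \<Rightarrow> 'n tensor4" where
  "kn3 h \<omega> x i j k l = (\<Sum>a\<in>UNIV. \<Sum>b\<in>UNIV. ginv h x a b *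
     (\<omega> x k i a * \<omega> x j l b - \<omega> x k j a * \<omega> x i l b))"

definition norm2 :: "'n::finite tensor2 \<Rightarrow> 'n tensor3 \<Rightarrow> real^'n \<Rightarrow> real" where
  "norm2 h \<omega> x = (\<Sum>i\<in>UNIV. \<Sum>j\<in>UNIV. \<Sum>k\<in>UNIV. \<Sum>a\<in>UNIV. \<Sum>b\<in>UNIV. \<Sum>c\<in>UNIV.
     ginv h x i a * ginv h x j b * ginv h x k c * \<omega> x a b c * \<omega> x i j k)"

section \<open>Tensor fields and connections on a manifold\<close>

text \<open>A field on the manifold is the family of its components in the charts of the atlas, smooth
  and subject to the transformation law on overlaps.\<close>

definition jac :: "('m, 'n::finite) chart \<Rightarrow> ('m, 'n) chart \<Rightarrow> real^'n \<Rightarrow> 'n \<Rightarrow> 'n \<Rightarrow> real" where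
  "jac c d x i k = pd i (\<lambda>y. transition c d y $ k) x"

definition metric_field ::
    "('m, 'n::finite) chart set \<Rightarrow> (('m, 'n) chart \<Rightarrow> 'n tensor2) \<Rightarrow> bool" where
  "metric_field A h \<longleftrightarrow>
     (\<forall>c\<in>A. \<forall>i j. smooth_on (coords c) (\<lambda>x. h c x i j)) \<and>
     (\<forall>c\<in>A. \<forall>x\<in>coords c. \<forall>i j. h c x i j = h c x j i) \<and>
     (\<forall>c\<in>A. \<forall>x\<in>coords c. invertible (\<chi> i j. h c x i j)) \<and>
     (\<forall>c\<in>A. \<forall>d\<in>A. \<forall>x\<in>overlap c d. \<forall>i j. h c x i j =
        (\<Sum>p\<in>UNIV. \<Sum>q\<in>UNIV. jac c d x i p * jac c d x j q * h d (transition c d x) p q))"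

definition symmetric3_field ::
    "('m, 'n::finite) chart set \<Rightarrow> (('m, 'n) chart \<Rightarrow> 'n tensor3) \<Rightarrow> bool" where
  "symmetric3_field A \<omega> \<longleftrightarrow>
     (\<forall>c\<in>A. \<forall>i j k. smooth_on (coords c) (\<lambda>x. \<omega> c x i j k)) \<and>
     (\<forall>c\<in>A. \<forall>x\<in>coords c. \<forall>i j k. \<omega> c x i j k = \<omega> c x j i k \<and> \<omega> c x i j k = \<omega> c x i k j) \<and>
     (\<forall>c\<in>A. \<forall>d\<in>A. \<forall>x\<in>overlap c d. \<forall>i j k. \<omega> c x i j k =
        (\<Sum>p\<in>UNIV. \<Sum>q\<in>UNIV. \<Sum>r\<in>UNIV. jac c d x i p * jac c d x j q * jac c d x k r *
           \<omega> d (transition c d x) p q r))"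

definition affine_connection ::
    "('m, 'n::finite) chart set \<Rightarrow> (('m, 'n) chart \<Rightarrow> 'n tensor3) \<Rightarrow> bool" where
  "affine_connection A \<Gamma> \<longleftrightarrow>
     (\<forall>c\<in>A. \<forall>i j k. smooth_on (coords c) (\<lambda>x. \<Gamma> c x i j k)) \<and>
     (\<forall>c\<in>A. \<forall>d\<in>A. \<forall>x\<in>overlap c d. \<forall>i j k.
        (\<Sum>m\<in>UNIV. \<Gamma> c x i j m * jac c d x m k) =
          pd i (\<lambda>y. jac c d y j k) x +
          (\<Sum>p\<in>UNIV. \<Sum>q\<in>UNIV. jac c d x i p * jac c d x j q * \<Gamma> d (transition c d x) p q k))"

definition torsion_free ::
    "('m, 'n::finite) chart set \<Rightarrow> (('m, 'n) chart \<Rightarrow> 'n tensor3) \<Rightarrow> bool" where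
  "torsion_free A \<Gamma> \<longleftrightarrow> (\<forall>c\<in>A. \<forall>x\<in>coords c. \<forall>i j k. \<Gamma> c x i j k = \<Gamma> c x j i k)"

section \<open>Statistical structures\<close>

definition statistical_structure ::
    "('m, 'n::finite) chart set \<Rightarrow> (('m, 'n) chart \<Rightarrow> 'n tensor3) \<Rightarrow>
       (('m, 'n) chart \<Rightarrow> 'n tensor2) \<Rightarrow> bool" where
  "statistical_structure A \<Gamma> h \<longleftrightarrow>
     metric_field A h \<and> affine_connection A \<Gamma> \<and> torsion_free A \<Gamma> \<and>
     (\<forall>c\<in>A. \<forall>x\<in>coords c. \<forall>i j k. cov2 (\<Gamma> c) (h c) x i j k = cov2 (\<Gamma> c) (h c) x j i k)"

definition cubic_form ::
    "(('m, 'n::finite) chart \<Rightarrow> 'n tensor3) \<Rightarrow> (('m, 'n) chart \<Rightarrow> 'n tensor2) \<Rightarrow>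
       ('m, 'n) chart \<Rightarrow> 'n tensor3" where
  "cubic_form \<Gamma> h c = cov2 (\<Gamma> c) (h c)"

definition conjugate ::
    "(('m, 'n::finite) chart \<Rightarrow> 'n tensor3) \<Rightarrow> (('m, 'n) chart \<Rightarrow> 'n tensor2) \<Rightarrow>
       ('m, 'n) chart \<Rightarrow> 'n tensor3" where
  "conjugate \<Gamma> h c x i j k =
     \<Gamma> c x i j k + (\<Sum>p\<in>UNIV. ginv (h c) x k p * cov2 (\<Gamma> c) (h c) x i j p)"

text \<open>\<open>det h\<close> is a section of the square of the bundle of \<open>n\<close>-forms, whence the factor \<open>2\<close> in
  \<open>\<nabla>\<^sub>i det h = \<partial>\<^sub>i det h - 2 \<Gamma>\<^sub>i\<^sub>p\<^sup>p det h\<close>. Lemma \<open>cov_det_eq\<close> below gives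
  \<open>\<nabla>\<^sub>i det h = (det h) h\<^sup>j\<^sup>k \<nabla>\<^sub>i h\<^sub>j\<^sub>k\<close>.\<close>

definition det_h :: "'n::finite tensor2 \<Rightarrow> real^'n \<Rightarrow> real" where
  "det_h h x = det (\<chi> i j. h x i j)"

definition cov_det :: "'n::finite tensor3 \<Rightarrow> 'n tensor2 \<Rightarrow> 'n tensor1" where
  "cov_det \<Gamma> h x i = pd i (det_h h) x - 2 * (\<Sum>p\<in>UNIV. \<Gamma> x i p p) * det_h h x"

definition special_statistical_structure ::
    "('m, 'n::finite) chart set \<Rightarrow> (('m, 'n) chart \<Rightarrow> 'n tensor3) \<Rightarrow>
       (('m, 'n) chart \<Rightarrow> 'n tensor2) \<Rightarrow> bool" where
  "special_statistical_structure A \<Gamma> h \<longleftrightarrow> statistical_structure A \<Gamma> h \<and>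
     (\<forall>c\<in>A. \<forall>x\<in>coords c. \<forall>i. cov_det (\<Gamma> c) (h c) x i = 0)"

definition scalar_curvature :: "'n::finite tensor3 \<Rightarrow> 'n tensor2 \<Rightarrow> real^'n \<Rightarrow> real" where
  "scalar_curvature \<Gamma> h = trace_h h (rho (curvature \<Gamma>))"

definition scalar_curvature_is ::
    "('m, 'n::finite) chart set \<Rightarrow> (('m, 'n) chart \<Rightarrow> 'n tensor3) \<Rightarrow>
       (('m, 'n) chart \<Rightarrow> 'n tensor2) \<Rightarrow> real \<Rightarrow> bool" where
  "scalar_curvature_is A \<Gamma> h \<kappa> \<longleftrightarrow>
     (\<forall>c\<in>A. \<forall>x\<in>coords c. scalar_curvature (\<Gamma> c) (h c) x = \<kappa>)"

definition constant_scalar_curvature ::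
    "('m, 'n::finite) chart set \<Rightarrow> (('m, 'n) chart \<Rightarrow> 'n tensor3) \<Rightarrow>
       (('m, 'n) chart \<Rightarrow> 'n tensor2) \<Rightarrow> bool" where
  "constant_scalar_curvature A \<Gamma> h \<longleftrightarrow> (\<exists>\<kappa>. scalar_curvature_is A \<Gamma> h \<kappa>)"

definition self_conjugate_curvature ::
    "('m, 'n::finite) chart set \<Rightarrow> (('m, 'n) chart \<Rightarrow> 'n tensor3) \<Rightarrow>
       (('m, 'n) chart \<Rightarrow> 'n tensor2) \<Rightarrow> bool" where
  "self_conjugate_curvature A \<Gamma> h \<longleftrightarrow> (\<forall>c\<in>A. \<forall>x\<in>coords c. \<forall>i j k l.
     curvature (\<Gamma> c) x i j k l = curvature (conjugate \<Gamma> h c) x i j k l)"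

definition einstein ::
    "('m, 'n::finite) chart set \<Rightarrow> (('m, 'n) chart \<Rightarrow> 'n tensor3) \<Rightarrow>
       (('m, 'n) chart \<Rightarrow> 'n tensor2) \<Rightarrow> bool" where
  "einstein A \<Gamma> h \<longleftrightarrow>
     (\<forall>c\<in>A. \<forall>x\<in>coords c. \<exists>f. \<forall>i j. rho (curvature (\<Gamma> c)) x i j = f * h c x i j) \<and>
     (\<forall>c\<in>A. \<forall>x\<in>coords c. \<exists>f. \<forall>i j.
        rho (curvature (conjugate \<Gamma> h c)) x i j = f * h c x i j) \<and>
     constant_scalar_curvature A \<Gamma> h"

definition constant_curvature ::
    "('m, 'n::finite) chart set \<Rightarrow> (('m, 'n) chart \<Rightarrow> 'n tensor3) \<Rightarrow>
       (('m, 'n) chart \<Rightarrow> 'n tensor2) \<Rightarrow> bool" where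
  "constant_curvature A \<Gamma> h \<longleftrightarrow> (\<exists>\<alpha>. \<forall>c\<in>A. \<forall>x\<in>coords c. \<forall>i j k l.
     lower_last (h c) (curvature (\<Gamma> c)) x i j k l = \<alpha> * kn2 (h c) x i j k l)"

section \<open>The coupled equations\<close>

text \<open>The conditions on \<open>\<omega>\<close> common to all three systems.\<close>

definition tracefree_codazzi ::
    "('m, 'n::finite) chart set \<Rightarrow> (('m, 'n) chart \<Rightarrow> 'n tensor2) \<Rightarrow>
       (('m, 'n) chart \<Rightarrow> 'n tensor3) \<Rightarrow> bool" where
  "tracefree_codazzi A h \<omega> \<longleftrightarrow> symmetric3_field A \<omega> \<and>
     (\<forall>c\<in>A. \<forall>x\<in>coords c. \<forall>i. (\<Sum>j\<in>UNIV. \<Sum>k\<in>UNIV. ginv (h c) x j k * \<omega> c x i j k) = 0) \<and>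
     (\<forall>c\<in>A. \<forall>x\<in>coords c. \<forall>i j k l.
        cov3 (levi_civita (h c)) (\<omega> c) x i j k l = cov3 (levi_civita (h c)) (\<omega> c) x j i k l)"

definition coupled_projectively_flat ::
    "('m, 'n::finite) chart set \<Rightarrow> (('m, 'n) chart \<Rightarrow> 'n tensor2) \<Rightarrow>
       (('m, 'n) chart \<Rightarrow> 'n tensor3) \<Rightarrow> real \<Rightarrow> real \<Rightarrow> bool" where
  "coupled_projectively_flat A h \<omega> c \<kappa> \<longleftrightarrow> metric_field A h \<and> tracefree_codazzi A h \<omega> \<and>
     (\<forall>u\<in>A. \<forall>x\<in>coords u. \<forall>i j k l.
        Riem (h u) x i j k l - c * kn3 (h u) (\<omega> u) x i j k l =
        - (\<kappa> / (real CARD('n) * (real CARD('n) - 1))) * kn2 (h u) x i j k l)"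

definition coupled_einstein ::
    "('m, 'n::finite) chart set \<Rightarrow> (('m, 'n) chart \<Rightarrow> 'n tensor2) \<Rightarrow>
       (('m, 'n) chart \<Rightarrow> 'n tensor3) \<Rightarrow> real \<Rightarrow> real \<Rightarrow> bool" where
  "coupled_einstein A h \<omega> c \<kappa> \<longleftrightarrow> metric_field A h \<and> tracefree_codazzi A h \<omega> \<and>
     (\<forall>u\<in>A. \<forall>x\<in>coords u. \<forall>i j.
        Ric (h u) x i j - 1 / 2 * scal (h u) x * h u x i j
          + (real CARD('n) - 2) / (2 * real CARD('n)) * \<kappa> * h u x i j =
        c * (rho (raise_last (h u) (kn3 (h u) (\<omega> u))) x i j
               - 1 / 2 * norm2 (h u) (\<omega> u) x * h u x i j))"

definition coupled_constraint ::
    "('m, 'n::finite) chart set \<Rightarrow> (('m, 'n) chart \<Rightarrow> 'n tensor2) \<Rightarrow>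
       (('m, 'n) chart \<Rightarrow> 'n tensor3) \<Rightarrow> real \<Rightarrow> real \<Rightarrow> bool" where
  "coupled_constraint A h \<omega> c \<kappa> \<longleftrightarrow> metric_field A h \<and> tracefree_codazzi A h \<omega> \<and>
     (\<forall>u\<in>A. \<forall>x\<in>coords u. \<forall>i. pd i (\<lambda>y. scal (h u) y - c * norm2 (h u) (\<omega> u) y) x = 0) \<and>
     (\<forall>u\<in>A. \<forall>x\<in>coords u. scal (h u) x - c * norm2 (h u) (\<omega> u) x = \<kappa>)"

section \<open>Consistency of the coordinate definitions\<close>

lemma pd_eqI: "(f has_derivative f') (at x) \<Longrightarrow> pd i f x = f' (axis i 1)"
  by (metis frechet_derivative_at pd_def)

lemma pd_works: "f differentiable (at x) \<Longrightarrow> (f has_derivative frechet_derivative f (at x)) (at x)"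
  by (simp add: frechet_derivative_works)

lemma pd_const [simp]: "pd i (\<lambda>y. c) x = 0"
  by (simp add: pd_def)

lemma pd_add:
  assumes "f differentiable (at x)" "g differentiable (at x)"
  shows "pd i (\<lambda>y. f y + g y) x = pd i f x + pd i g x"
  using has_derivative_add[OF assms[THEN pd_works]] by (simp add: pd_eqI pd_def[of i f] pd_def[of i g])

lemma pd_diff:
  assumes "f differentiable (at x)" "g differentiable (at x)"
  shows "pd i (\<lambda>y. f y - g y) x = pd i f x - pd i g x"
  using has_derivative_diff[OF assms[THEN pd_works]] by (simp add: pd_eqI pd_def[of i f] pd_def[of i g])

lemma pd_minus:
  assumes "f differentiable (at x)"
  shows "pd i (\<lambda>y. - f y) x = - pd i f x"
  using has_derivative_minus[OF assms[THEN pd_works]] by (simp add: pd_eqI pd_def[of i f])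

lemma pd_mult:
  assumes "f differentiable (at x)" "g differentiable (at x)"
  shows "pd i (\<lambda>y. f y * g y) x = pd i f x * g x + f x * pd i g x"
  using has_derivative_mult[OF assms[THEN pd_works]] by (simp add: pd_eqI pd_def[of i f] pd_def[of i g])

lemma pd_sum:
  assumes "\<And>p. p \<in> I \<Longrightarrow> f p differentiable (at x)"
  shows "pd i (\<lambda>y. \<Sum>p\<in>I. f p y) x = (\<Sum>p\<in>I. pd i (f p) x)"
proof -
  have "((\<lambda>y. \<Sum>p\<in>I. f p y) has_derivative (\<lambda>v. \<Sum>p\<in>I. frechet_derivative (f p) (at x) v)) (at x)"
    by (intro has_derivative_sum pd_works assms)
  then show ?thesis by (simp add: pd_eqI) (simp add: pd_def)
qed

lemma second_difference:
  fixes f :: "real^'n::finite \<Rightarrow> real"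
  assumes S: "open S" "Ck_on 2 S f" and r: "ball x r \<subseteq> S" and t: "0 < t" "2 * t < r"
  shows "\<exists>z. dist x z \<le> 2 * t \<and>
    f (x + t *\<^sub>R axis i 1 + t *\<^sub>R axis j 1) - f (x + t *\<^sub>R axis i 1)
      - f (x + t *\<^sub>R axis j 1) + f x = t * t * pd j (pd i f) z"
proof -
  let ?ei = "axis i (1::real)" and ?ej = "axis j (1::real)"
  have Ck: "\<And>y. y \<in> S \<Longrightarrow> f differentiable (at y)"
       "\<And>y k. y \<in> S \<Longrightarrow> pd k f differentiable (at y)"
    using S(2) by (simp_all add: numeral_2_eq_2)
  have close: "dist x (x + a *\<^sub>R ?ei + b *\<^sub>R ?ej) \<le> 2 * t"
    if "0 \<le> a" "a \<le> t" "0 \<le> b" "b \<le> t" for a b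
  proof -
    have "norm (a *\<^sub>R ?ei + b *\<^sub>R ?ej) \<le> norm (a *\<^sub>R ?ei) + norm (b *\<^sub>R ?ej)"
      by (rule norm_triangle_ineq)
    also have "\<dots> \<le> 2 * t" using that by (simp add: norm_axis_1)
    finally show ?thesis by (metis add.assoc add_diff_cancel_left' dist_commute dist_norm)
  qed
  have inS: "x + a *\<^sub>R ?ei + b *\<^sub>R ?ej \<in> S"
    if "0 \<le> a" "a \<le> t" "0 \<le> b" "b \<le> t" for a b
    using order_le_less_trans[OF close[OF that] t(2)] r by auto
  have line: "((\<lambda>s. g (p + s *\<^sub>R axis k 1)) has_real_derivative pd k g (p + s *\<^sub>R axis k 1)) (at s)"
    if "g differentiable (at (p + s *\<^sub>R axis k 1))" for g :: "real^'n \<Rightarrow> real" and p k s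
  proof -
    have 1: "((\<lambda>s. p + s *\<^sub>R axis k 1) has_derivative (\<lambda>u. u *\<^sub>R axis k 1)) (at s)"
      by (auto intro!: derivative_eq_intros)
    have 2: "((\<lambda>s. g (p + s *\<^sub>R axis k 1)) has_derivative
       (\<lambda>u. frechet_derivative g (at (p + s *\<^sub>R axis k 1)) (u *\<^sub>R axis k 1))) (at s)"
      using has_derivative_compose[OF 1 pd_works[OF that]] .
    have "frechet_derivative g (at (p + s *\<^sub>R axis k 1)) (u *\<^sub>R axis k 1) =
          pd k g (p + s *\<^sub>R axis k 1) * u" for u
      using linear_scale[OF linear_frechet_derivative[OF that]] by (simp add: pd_def)
    then show ?thesis using 2 by (simp add: has_field_derivative_def)
  qed
  have sw: "x + t *\<^sub>R ?ej + s *\<^sub>R ?ei = x + s *\<^sub>R ?ei + t *\<^sub>R ?ej" for s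
    by (simp only: add.assoc add.commute[of "t *\<^sub>R ?ej"])
  let ?u = "\<lambda>s. f ((x + t *\<^sub>R ?ej) + s *\<^sub>R ?ei) - f (x + s *\<^sub>R ?ei)"
  have "\<exists>\<xi>. 0 < \<xi> \<and> \<xi> < t \<and> ?u t - ?u 0 =
      (t - 0) * (pd i f ((x + t *\<^sub>R ?ej) + \<xi> *\<^sub>R ?ei) - pd i f (x + \<xi> *\<^sub>R ?ei))"
  proof (rule MVT2[OF t(1)])
    fix s assume s: "0 \<le> s" "s \<le> t"
    have "x + t *\<^sub>R ?ej + s *\<^sub>R ?ei \<in> S"
      unfolding sw by (rule inS) (use s t in auto)
    moreover have "x + s *\<^sub>R ?ei \<in> S"
      using inS[of s 0] s t by simp
    ultimately show "(?u has_real_derivative pd i f ((x + t *\<^sub>R ?ej) + s *\<^sub>R ?ei) - pd i f (x + s *\<^sub>R ?ei)) (at s)"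
      by (intro DERIV_diff line Ck)
  qed
  then obtain \<xi> where \<xi>: "0 < \<xi>" "\<xi> < t" "?u t - ?u 0 =
      t * (pd i f ((x + t *\<^sub>R ?ej) + \<xi> *\<^sub>R ?ei) - pd i f (x + \<xi> *\<^sub>R ?ei))" by auto
  let ?v = "\<lambda>s. pd i f ((x + \<xi> *\<^sub>R ?ei) + s *\<^sub>R ?ej)"
  have "\<exists>\<eta>. 0 < \<eta> \<and> \<eta> < t \<and> ?v t - ?v 0 =
      (t - 0) * pd j (pd i f) ((x + \<xi> *\<^sub>R ?ei) + \<eta> *\<^sub>R ?ej)"
  proof (rule MVT2[OF t(1)])
    fix s assume s: "0 \<le> s" "s \<le> t"
    show "(?v has_real_derivative pd j (pd i f) ((x + \<xi> *\<^sub>R ?ei) + s *\<^sub>R ?ej)) (at s)"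
      using inS[of \<xi> s] s \<xi> by (intro line Ck) simp_all
  qed
  then obtain \<eta> where \<eta>: "0 < \<eta>" "\<eta> < t"
    "?v t - ?v 0 = t * pd j (pd i f) ((x + \<xi> *\<^sub>R ?ei) + \<eta> *\<^sub>R ?ej)" by auto
  have "?u t - ?u 0 = t * (t * pd j (pd i f) ((x + \<xi> *\<^sub>R ?ei) + \<eta> *\<^sub>R ?ej))"
    using \<xi>(3) \<eta>(3) by (simp add: sw[of \<xi>])
  moreover have "dist x (x + \<xi> *\<^sub>R ?ei + \<eta> *\<^sub>R ?ej) \<le> 2 * t"
    using close \<xi> \<eta> by simp
  ultimately show ?thesis
    by (intro exI[of _ "x + \<xi> *\<^sub>R ?ei + \<eta> *\<^sub>R ?ej"]) (simp add: sw[of t])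
qed

lemma pd_commute:
  fixes f :: "real^'n::finite \<Rightarrow> real"
  assumes S: "open S" "Ck_on 2 S f" "x \<in> S"
  shows "pd i (pd j f) x = pd j (pd i f) x"
proof (rule ccontr)
  assume ne: "pd i (pd j f) x \<noteq> pd j (pd i f) x"
  define e where "e = \<bar>pd i (pd j f) x - pd j (pd i f) x\<bar> / 2"
  have e: "e > 0" using ne by (simp add: e_def)
  have cont: "continuous (at x) (pd i (pd j f))" for i j
    using S by (simp add: numeral_2_eq_2 continuous_on_eq_continuous_at)
  obtain d1 where d1: "d1 > 0" "\<And>z. dist z x < d1 \<Longrightarrow> dist (pd i (pd j f) z) (pd i (pd j f) x) < e"
    using cont[of i j] e unfolding continuous_at_eps_delta by metis
  obtain d2 where d2: "d2 > 0" "\<And>z. dist z x < d2 \<Longrightarrow> dist (pd j (pd i f) z) (pd j (pd i f) x) < e"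
    using cont[of j i] e unfolding continuous_at_eps_delta by metis
  obtain r where r: "r > 0" "ball x r \<subseteq> S" using S open_contains_ball by blast
  define t where "t = min r (min d1 d2) / 3"
  have t: "0 < t" "2 * t < r" "2 * t < d1" "2 * t < d2" using r d1 d2 by (auto simp: t_def)
  obtain z1 where z1: "dist x z1 \<le> 2 * t" 
    "f (x + t *\<^sub>R axis j 1 + t *\<^sub>R axis i 1) - f (x + t *\<^sub>R axis j 1)
      - f (x + t *\<^sub>R axis i 1) + f x = t * t * pd i (pd j f) z1"
    using second_difference[OF S(1,2) r(2) t(1,2)] by blast
  obtain z2 where z2: "dist x z2 \<le> 2 * t" 
    "f (x + t *\<^sub>R axis i 1 + t *\<^sub>R axis j 1) - f (x + t *\<^sub>R axis i 1)
      - f (x + t *\<^sub>R axis j 1) + f x = t * t * pd j (pd i f) z2"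
    using second_difference[OF S(1,2) r(2) t(1,2)] by blast
  have "t * t * pd i (pd j f) z1 = t * t * pd j (pd i f) z2"
    using z1(2) z2(2) by (simp add: algebra_simps)
  then have "pd i (pd j f) z1 = pd j (pd i f) z2" using t by simp
  moreover have "dist (pd i (pd j f) z1) (pd i (pd j f) x) < e"
    using d1(2)[of z1] z1(1) t by (simp add: dist_commute)
  moreover have "dist (pd j (pd i f) z2) (pd j (pd i f) x) < e"
    using d2(2)[of z2] z2(1) t by (simp add: dist_commute)
  moreover have "False" if "dist a b < \<bar>b - c\<bar> / 2" "dist a c < \<bar>b - c\<bar> / 2" for a b c :: real
    using that by (auto simp: dist_real_def abs_if split: if_splits)
  ultimately show False unfolding e_def by metis
qed

lemma pd_coform [simp]: "pd i (\<lambda>y. coform l y k) x = 0"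
  by (simp add: coform_def)

lemma curvature_eq:
  fixes \<Gamma> :: "'n::finite tensor3"
  assumes D: "\<And>i j k. (\<lambda>y. \<Gamma> y i j k) differentiable (at x)"
    and sym: "\<And>i j k. \<Gamma> x i j k = \<Gamma> x j i k"
  shows "curvature \<Gamma> x i j k l = pd i (\<lambda>y. \<Gamma> y j k l) x - pd j (\<lambda>y. \<Gamma> y i k l) x
     + (\<Sum>p\<in>UNIV. \<Gamma> x i p l * \<Gamma> x j k p) - (\<Sum>p\<in>UNIV. \<Gamma> x j p l * \<Gamma> x i k p)"
proof -
  have c1: "cov1 \<Gamma> (coform l) = (\<lambda>y j k. - \<Gamma> y j k l)" for l
    by (intro ext) (simp add: cov1_def, simp add: coform_def mult_delta_right)
  show ?thesis
    unfolding curvature_def cov2_def c1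
    by (simp add: pd_minus D sum_negf sym[of j i] algebra_simps)
qed

lemma ricci_identity:
  fixes \<Gamma> :: "'n::finite tensor3" and \<alpha> :: "'n tensor1"
  assumes S: "open S" "x \<in> S"
    and \<Gamma>: "\<And>i j k. smooth_on S (\<lambda>y. \<Gamma> y i j k)"
    and \<alpha>: "\<And>i. smooth_on S (\<lambda>y. \<alpha> y i)"
    and sym: "\<And>i j k. \<Gamma> x i j k = \<Gamma> x j i k"
  shows "cov2 \<Gamma> (cov1 \<Gamma> \<alpha>) x i j k - cov2 \<Gamma> (cov1 \<Gamma> \<alpha>) x j i k =
    - (\<Sum>p\<in>UNIV. curvature \<Gamma> x i j k p * \<alpha> x p)"
proof -
  have Ck2: "Ck_on 2 S (\<lambda>y. \<alpha> y i)" "Ck_on 2 S (\<lambda>y. \<Gamma> y i j k)" for i j k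
    using \<Gamma> \<alpha> by (simp_all add: smooth_on_def)
  then have D: "(\<lambda>y. \<alpha> y i) differentiable (at x)" "(\<lambda>y. \<Gamma> y i j k) differentiable (at x)"
       "pd j (\<lambda>y. \<alpha> y i) differentiable (at x)" for i j k
    using S by (simp_all add: numeral_2_eq_2)
  have ddc: "pd i (\<lambda>y. cov1 \<Gamma> \<alpha> y j k) x = pd i (pd j (\<lambda>y. \<alpha> y k)) x
      - (\<Sum>p\<in>UNIV. pd i (\<lambda>y. \<Gamma> y j k p) x * \<alpha> x p + \<Gamma> x j k p * pd i (\<lambda>y. \<alpha> y p) x)" for i j
    unfolding cov1_def by (simp add: pd_diff pd_sum pd_mult D differentiable_sum differentiable_mult)
  have com: "pd i (pd j (\<lambda>y. \<alpha> y k)) x = pd j (pd i (\<lambda>y. \<alpha> y k)) x"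
    using pd_commute[OF S(1) Ck2(1) S(2)] .
  have cc: "(\<Sum>p\<in>UNIV. \<Gamma> x i k p * cov1 \<Gamma> \<alpha> x j p) = (\<Sum>p\<in>UNIV. \<Gamma> x i k p * pd j (\<lambda>y. \<alpha> y p) x)
     - (\<Sum>p\<in>UNIV. (\<Sum>q\<in>UNIV. \<Gamma> x j q p * \<Gamma> x i k q) * \<alpha> x p)" for i j
  proof -
    have "(\<Sum>p\<in>UNIV. \<Gamma> x i k p * (\<Sum>q\<in>UNIV. \<Gamma> x j p q * \<alpha> x q)) =
       (\<Sum>p\<in>UNIV. (\<Sum>q\<in>UNIV. \<Gamma> x j q p * \<Gamma> x i k q) * \<alpha> x p)"
      unfolding sum_distrib_left sum_distrib_right
      by (subst sum.swap) (simp add: ac_simps)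
    then show ?thesis by (simp add: cov1_def right_diff_distrib sum_subtractf)
  qed
  have s: "(\<Sum>p\<in>UNIV. \<Gamma> x j i p * cov1 \<Gamma> \<alpha> x p k) = (\<Sum>p\<in>UNIV. \<Gamma> x i j p * cov1 \<Gamma> \<alpha> x p k)"
    by (simp only: sym[of j i])
  show ?thesis
    unfolding cov2_def ddc cc s com curvature_eq[OF D(2) sym]
    by (simp add: distrib_right left_diff_distrib sum.distrib sum_subtractf)
qed

lemma ginv_inverse:
  fixes h :: "'n::finite tensor2"
  assumes "invertible (\<chi> i j. h x i j)"
  shows "(\<Sum>k\<in>UNIV. ginv h x i k * h x k j) = (if i = j then 1 else 0)"
    and "(\<Sum>k\<in>UNIV. h x i k * ginv h x k j) = (if i = j then 1 else 0)"
proof -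
  let ?H = "\<chi> i j. h x i j"
  have "matrix_inv ?H ** ?H = mat 1 \<and> ?H ** matrix_inv ?H = mat 1"
    using assms unfolding invertible_def matrix_inv_def by (metis (mono_tags, lifting) someI_ex)
  then have "(matrix_inv ?H ** ?H) $ i $ j = mat 1 $ i $ j" "(?H ** matrix_inv ?H) $ i $ j = mat 1 $ i $ j"
    by simp_all
  then show "(\<Sum>k\<in>UNIV. ginv h x i k * h x k j) = (if i = j then 1 else 0)"
    and "(\<Sum>k\<in>UNIV. h x i k * ginv h x k j) = (if i = j then 1 else 0)"
    by (simp_all add: matrix_matrix_mult_def mat_def ginv_def)
qed

lemma ginv_sym:
  fixes h :: "'n::finite tensor2"
  assumes inv: "invertible (\<chi> i j. h x i j)" and sym: "\<And>i j. h x i j = h x j i"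
  shows "ginv h x j k = ginv h x k j"
proof -
  note g = ginv_inverse[where h = h and x = x, OF inv]
  have "ginv h x j k = (\<Sum>m\<in>UNIV. ginv h x j m * (\<Sum>q\<in>UNIV. ginv h x k q * h x q m))"
    by (simp add: g mult_delta_right)
  also have "\<dots> = (\<Sum>q\<in>UNIV. ginv h x k q * (\<Sum>m\<in>UNIV. ginv h x j m * h x m q))"
    unfolding sum_distrib_left by (subst sum.swap) (simp add: sym ac_simps)
  also have "\<dots> = ginv h x k j" by (simp add: g mult_delta_right)
  finally show ?thesis .
qed

lemma levi_civita_iff:
  fixes h :: "'n::finite tensor2" and \<Gamma> :: "'n tensor3"
  assumes inv: "invertible (\<chi> i j. h x i j)"
    and sym: "\<And>y i j. y \<in> S \<Longrightarrow> h y i j = h y j i" and S: "open S" "x \<in> S"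
    and D: "\<And>i j. (\<lambda>y. h y i j) differentiable (at x)"
  shows "(\<forall>i j k. \<Gamma> x i j k = \<Gamma> x j i k) \<and> (\<forall>i j k. cov2 \<Gamma> h x i j k = 0) \<longleftrightarrow>
    (\<forall>i j k. \<Gamma> x i j k = levi_civita h x i j k)"
proof -
  have hs: "h x i j = h x j i" for i j using sym S by blast
  have ds: "pd i (\<lambda>y. h y j k) x = pd i (\<lambda>y. h y k j) x" for i j k
    unfolding pd_def
    by (subst frechet_derivative_transform_within_open[where g = "\<lambda>y. h y k j", OF D S])
       (simp_all add: sym)
  define G where "G i j l = (\<Sum>k\<in>UNIV. \<Gamma> x i j k * h x k l)" for i j l
  define C where "C i j l = (pd i (\<lambda>y. h y j l) x + pd j (\<lambda>y. h y i l) x - pd l (\<lambda>y. h y i j) x) / 2"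
    for i j l
  have lc: "levi_civita h x i j k = (\<Sum>l\<in>UNIV. ginv h x k l * C i j l)" for i j k
    by (simp add: levi_civita_def C_def sum_divide_distrib)
  have cov: "cov2 \<Gamma> h x i j k = pd i (\<lambda>y. h y j k) x - G i j k - G i k j" for i j k
    by (simp add: cov2_def G_def hs[of j])
  have low: "(\<forall>i j k. \<Gamma> x i j k = levi_civita h x i j k) \<longleftrightarrow> (\<forall>i j l. G i j l = C i j l)"
  proof safe
    fix i j l assume a: "\<forall>i j k. \<Gamma> x i j k = levi_civita h x i j k"
    have "G i j l = (\<Sum>k\<in>UNIV. \<Sum>m\<in>UNIV. ginv h x k m * C i j m * h x k l)"
      by (simp add: G_def a lc sum_distrib_right)
    also have "\<dots> = (\<Sum>m\<in>UNIV. C i j m * (\<Sum>k\<in>UNIV. h x l k * ginv h x k m))"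
      unfolding sum_distrib_left by (subst sum.swap) (simp add: hs[of _ l] ac_simps)
    finally show "G i j l = C i j l" by (simp add: ginv_inverse[where h = h and x = x, OF inv] mult_delta_right)
  next
    fix i j k assume a: "\<forall>i j l. G i j l = C i j l"
    have "levi_civita h x i j k = (\<Sum>l\<in>UNIV. ginv h x k l * G i j l)" by (simp add: lc a)
    also have "\<dots> = (\<Sum>m\<in>UNIV. \<Gamma> x i j m * (\<Sum>l\<in>UNIV. ginv h x k l * h x l m))"
      unfolding sum_distrib_left G_def
      by (subst sum.swap) (simp add: hs ac_simps)
    finally show "\<Gamma> x i j k = levi_civita h x i j k" by (simp add: ginv_inverse[where h = h and x = x, OF inv] mult_delta_right)
  qed
  have symG: "(\<forall>i j k. \<Gamma> x i j k = \<Gamma> x j i k) \<longleftrightarrow> (\<forall>i j l. G i j l = G j i l)"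
  proof safe
    fix i j l assume "\<forall>i j k. \<Gamma> x i j k = \<Gamma> x j i k"
    then show "G i j l = G j i l" unfolding G_def by (intro sum.cong) auto
  next
    fix i j k assume a: "\<forall>i j l. G i j l = G j i l"
    have e: "\<Gamma> x i j k = (\<Sum>l\<in>UNIV. ginv h x k l * G i j l)" for i j
    proof -
      have "(\<Sum>l\<in>UNIV. ginv h x k l * G i j l) =
          (\<Sum>m\<in>UNIV. \<Gamma> x i j m * (\<Sum>l\<in>UNIV. ginv h x k l * h x l m))"
        unfolding sum_distrib_left G_def
        by (subst sum.swap) (simp add: hs ac_simps)
      then show ?thesis by (simp add: ginv_inverse[where h = h and x = x, OF inv] mult_delta_right)
    qed
    show "\<Gamma> x i j k = \<Gamma> x j i k"
      unfolding e[of i j] e[of j i] using a[rule_format, of i j] by simp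
  qed
  show ?thesis unfolding low symG cov
  proof safe
    fix i j l
    assume a: "\<forall>i j l. G i j l = G j i l" "\<forall>i j k. pd i (\<lambda>y. h y j k) x - G i j k - G i k j = 0"
    have "pd i (\<lambda>y. h y j k) x = G i j k + G i k j" for i j k
      using a(2)[rule_format, of i j k] by linarith
    then have "C i j l = (G i j l + G i l j + (G j i l + G j l i) - (G l i j + G l j i)) / 2"
      unfolding C_def by simp
    then show "G i j l = C i j l" using a(1)[rule_format, of i l j] a(1)[rule_format, of j l i] a(1)[rule_format, of j i l]
      by argo
  next
    fix i j l assume a: "\<forall>i j l. G i j l = C i j l"
    show "G i j l = G j i l"
      unfolding a[rule_format, of i j l] a[rule_format, of j i l] C_def by (simp add: ds[of l i j])
  next
    fix i j k assume a: "\<forall>i j l. G i j l = C i j l"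
    show "pd i (\<lambda>y. h y j k) x - G i j k - G i k j = 0"
      unfolding a[rule_format, of i j k] a[rule_format, of i k j] C_def
      by (simp add: field_simps ds[of i k j])
  qed
qed

lemma cov_det_eq:
  fixes h :: "'n::finite tensor2" and \<Gamma> :: "'n tensor3"
  assumes inv: "invertible (\<chi> i j. h x i j)" and sym: "\<And>i j. h x i j = h x j i"
    and D: "\<And>i j. (\<lambda>y. h y i j) differentiable (at x)"
  shows "cov_det \<Gamma> h x i =
    det_h h x * (\<Sum>j\<in>UNIV. \<Sum>k\<in>UNIV. ginv h x j k * cov2 \<Gamma> h x i j k)"
proof -
  let ?H = "\<chi> i j. h x i j"
  let ?P = "{p. p permutes (UNIV :: 'n set)}"
  define d where "d j k = pd i (\<lambda>y. h y j k) x" for j k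
  define B where "B j m = (\<Sum>k\<in>UNIV. d j k * ginv h x k m)" for j m
  have dB: "d j k = (\<Sum>m\<in>UNIV. B j m * h x m k)" for j k
  proof -
    have "(\<Sum>m\<in>UNIV. B j m * h x m k) =
        (\<Sum>q\<in>UNIV. d j q * (\<Sum>m\<in>UNIV. ginv h x q m * h x m k))"
      unfolding B_def sum_distrib_left sum_distrib_right
      by (subst sum.swap) (simp add: ac_simps)
    then show ?thesis by (simp add: ginv_inverse[where h = h and x = x, OF inv] mult_delta_right)
  qed
  have row: "det (\<chi> r. if r = k then (\<chi> q. d k q) else row r ?H) = B k k * det ?H" for k
  proof -
    have "(\<chi> q. d k q) = (\<Sum>m\<in>UNIV. (\<chi> m. B k m) $ m *s row m ?H)"
      by (simp add: vec_eq_iff dB row_def)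
    then show ?thesis using cramer_lemma_transpose[of k "\<chi> m. B k m" ?H]
      by (simp only: vec_lambda_beta)
  qed
  have prod: "pd i (\<lambda>y. \<Prod>r\<in>UNIV. h y r (p r)) x =
      (\<Sum>k\<in>UNIV. d k (p k) * (\<Prod>r\<in>UNIV - {k}. h x r (p r)))" for p
  proof -
    have "((\<lambda>y. \<Prod>r\<in>UNIV. h y r (p r)) has_derivative (\<lambda>v. \<Sum>k\<in>UNIV.
        frechet_derivative (\<lambda>y. h y k (p k)) (at x) v * (\<Prod>r\<in>UNIV - {k}. h x r (p r)))) (at x)"
      by (intro has_derivative_prod pd_works D)
    then show ?thesis by (simp add: pd_eqI d_def) (simp add: pd_def)
  qed
  have diffp: "(\<lambda>y. \<Prod>r\<in>UNIV. h y r (p r)) differentiable (at x)" for p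
    unfolding differentiable_def
    by (rule exI[of _ "\<lambda>v. \<Sum>k\<in>UNIV.
        frechet_derivative (\<lambda>y. h y k (p k)) (at x) v * (\<Prod>r\<in>UNIV - {k}. h x r (p r))"])
      (intro has_derivative_prod pd_works D)
  have "pd i (det_h h) x = (\<Sum>p\<in>?P. of_int (sign p) *
      (\<Sum>k\<in>UNIV. d k (p k) * (\<Prod>r\<in>UNIV - {k}. h x r (p r))))"
  proof -
    have e: "det_h h = (\<lambda>y. \<Sum>p\<in>?P. of_int (sign p) * (\<Prod>r\<in>UNIV. h y r (p r)))"
      by (intro ext) (simp add: det_h_def det_def)
    show ?thesis unfolding e
      by (subst pd_sum) (auto simp: differentiable_mult diffp pd_mult prod)
  qed
  also have "\<dots> = (\<Sum>k\<in>UNIV. det (\<chi> r. if r = k then (\<chi> q. d k q) else row r ?H))"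
  proof -
    have "det (\<chi> r. if r = k then (\<chi> q. d k q) else row r ?H) = (\<Sum>p\<in>?P. of_int (sign p) *
      (d k (p k) * (\<Prod>r\<in>UNIV - {k}. h x r (p r))))" for k
    proof -
      have "(\<Prod>r\<in>UNIV. (\<chi> r. if r = k then (\<chi> q. d k q) else row r ?H) $ r $ p r) =
          d k (p k) * (\<Prod>r\<in>UNIV - {k}. h x r (p r))" for p
        by (subst prod.remove[of _ k]) (auto simp: row_def intro!: prod.cong)
      then show ?thesis unfolding det_def by simp
    qed
    then show ?thesis unfolding sum_distrib_left by (simp add: sum.swap[of _ _ ?P])
  qed
  also have "\<dots> = (\<Sum>k\<in>UNIV. B k k) * det_h h x"
    by (simp add: row sum_distrib_right det_h_def)
  finally have J: "pd i (det_h h) x = (\<Sum>k\<in>UNIV. B k k) * det_h h x" .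
  have gs: "(\<Sum>j\<in>UNIV. \<Sum>k\<in>UNIV. ginv h x j k * (\<Sum>p\<in>UNIV. \<Gamma> x i j p * h x p k)) = (\<Sum>j\<in>UNIV. \<Gamma> x i j j)"
  proof -
    have "(\<Sum>k\<in>UNIV. ginv h x j k * (\<Sum>p\<in>UNIV. \<Gamma> x i j p * h x p k)) =
       (\<Sum>p\<in>UNIV. \<Gamma> x i j p * (\<Sum>k\<in>UNIV. ginv h x j k * h x k p))" for j
      unfolding sum_distrib_left by (subst sum.swap) (simp add: sym ac_simps)
    then show ?thesis by (simp add: ginv_inverse[where h = h and x = x, OF inv] mult_delta_right)
  qed
  have gs': "(\<Sum>j\<in>UNIV. \<Sum>k\<in>UNIV. ginv h x j k * (\<Sum>p\<in>UNIV. \<Gamma> x i k p * h x j p)) = (\<Sum>j\<in>UNIV. \<Gamma> x i j j)"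
  proof -
    have "(\<Sum>j\<in>UNIV. ginv h x j k * (\<Sum>p\<in>UNIV. \<Gamma> x i k p * h x j p)) =
       (\<Sum>p\<in>UNIV. \<Gamma> x i k p * (\<Sum>j\<in>UNIV. h x p j * ginv h x j k))" for k
      unfolding sum_distrib_left by (subst sum.swap) (simp add: sym ac_simps)
    then show ?thesis
      by (subst sum.swap) (simp add: ginv_inverse[where h = h and x = x, OF inv] mult_delta_right)
  qed
  have tB: "(\<Sum>j\<in>UNIV. \<Sum>k\<in>UNIV. ginv h x j k * d j k) = (\<Sum>k\<in>UNIV. B k k)"
    unfolding B_def
    by (intro sum.cong refl) (subst ginv_sym[where h = h and x = x, OF inv sym], simp add: mult.commute)
  have tr: "(\<Sum>j\<in>UNIV. \<Sum>k\<in>UNIV. ginv h x j k * cov2 \<Gamma> h x i j k) =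
      (\<Sum>k\<in>UNIV. B k k) - 2 * (\<Sum>j\<in>UNIV. \<Gamma> x i j j)"
    unfolding cov2_def d_def[symmetric]
    by (simp add: right_diff_distrib sum_subtractf gs gs' tB)
  show ?thesis unfolding cov_det_def J tr by (simp add: algebra_simps)
qed

end

theory Submission
  imports Defs
begin

text \<open>Write \<open>D\<close> for the Levi-Civita connection. In a statistical structure
  \<open>\<nabla>\<^sub>i \<partial>\<^sub>j = D\<^sub>i \<partial>\<^sub>j - 1/2 L\<^sub>i\<^sub>j\<^sup>k \<partial>\<^sub>k\<close>, and the conjugate connection has the opposite sign, so both
  belong to the family \<open>D + t L\<close> of deformations of \<open>D\<close> by a symmetric cubic tensor. The whole theorem
  rests on the curvature of this family (\<open>lower_last_curvature_deformation\<close>),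

  \<open>R\<^sub>i\<^sub>j\<^sub>k\<^sub>l = Riem\<^sub>i\<^sub>j\<^sub>k\<^sub>l + t (D\<^sub>i L\<^sub>j\<^sub>k\<^sub>l - D\<^sub>j L\<^sub>i\<^sub>k\<^sub>l) - t\<^sup>2 (L \<circledast> L)\<^sub>i\<^sub>j\<^sub>k\<^sub>l\<close>,

  whose middle term is symmetric in \<open>k\<close>, \<open>l\<close> while the two others and \<open>h \<circledast> h\<close> are antisymmetric there.

  Comparing \<open>t = -1/2\<close> with \<open>t = 1/2\<close> shows that the curvature is self-conjugate precisely when \<open>L\<close> is
  Codazzi. The double trace of the middle term vanishes identically, because its two halves differ by
  a renaming of contracted indices; hence always \<open>r = scal - |L|\<^sup>2/4\<close>, which settles the coupled
  constraint equations. If \<open>\<nabla>\<close> has constant curvature \<open>\<alpha>\<close>, then the part of \<open>R\<close> symmetric in \<open>k\<close>, \<open>l\<close>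
  vanishes, so \<open>L\<close> is Codazzi and what is left is the coupled projectively flat equation; a double trace
  identifies \<open>\<alpha>\<close> as \<open>-r/(n(n-1))\<close>. If \<open>L\<close> is Codazzi, then \<open>\<rho>(R) = Ric - \<rho>(L \<circledast> L)/4\<close>, and substituting
  \<open>scal = r + |L|\<^sup>2/4\<close> into the coupled Einstein equation turns it into \<open>\<rho>(R) = (r/n) h\<close>.

  All of this happens pointwise in one chart. The only statement that compares charts is that
  \<open>L = \<nabla>h\<close> is a tensor field (\<open>cov2_metric_transform\<close>).

  In coordinates it is best to work with lowered Christoffel symbols \<open>G\<^sub>i\<^sub>j\<^sub>l = \<Gamma>\<^sub>i\<^sub>j\<^sup>p h\<^sub>p\<^sub>l\<close>. For \<open>D + t L\<close> they
  are \<open>C\<^sub>i\<^sub>j\<^sub>l + t L\<^sub>i\<^sub>j\<^sub>l\<close> with \<open>C\<close> the Christoffel symbols of the first kind, and then \<open>h\<^sup>-\<^sup>1\<close> enters the curvature only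
  algebraically, through the bilinear form that it defines on the last indices. That \<open>h\<^sup>-\<^sup>1\<close> is
  differentiable still has to be known, to relate the derivatives of \<open>\<Gamma>\<close> to those of \<open>G\<close>.\<close>

section \<open>Calculus with partial derivatives\<close>

text \<open>The functions here are total, and off the coordinate domain their values are arbitrary. Identities
  between fields hold only on the domain; the next three lemmas allow them to be differentiated there.\<close>

lemma pd_cong:
  assumes "open S" "x \<in> S" "\<And>y. y \<in> S \<Longrightarrow> f y = g y"
  shows "pd i f x = pd i g x"
proof -
  have "(f has_derivative D) (at x) \<longleftrightarrow> (g has_derivative D) (at x)" for D
    using has_derivative_transform_within_open[OF _ assms(1,2)] assms(3) by metis
  then show ?thesis by (simp add: pd_def frechet_derivative_def)
qed

lemma differentiable_cong:
  fixes f g :: "real^'n::finite \<Rightarrow> real"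
  assumes "open S" "x \<in> S" "\<And>y. y \<in> S \<Longrightarrow> f y = g y" "f differentiable (at x)"
  shows "g differentiable (at x)"
  using has_derivative_transform_within_open[OF _ assms(1,2)] assms(3,4)
  unfolding differentiable_def by metis

lemma Ck_on_cong:
  assumes "open S" "\<And>y. y \<in> S \<Longrightarrow> f y = g y" "Ck_on k S f"
  shows "Ck_on k S g"
  using assms(2,3)
proof (induction k arbitrary: f g)
  case 0
  then show ?case by (simp cong: continuous_on_cong)
next
  case (Suc k)
  have "g differentiable (at x)" if "x \<in> S" for x
    using differentiable_cong[OF assms(1) that Suc.prems(1)] Suc.prems(2) that by auto
  moreover have "Ck_on k S (pd i g)" for i
  proof (rule Suc.IH)
    show "pd i f y = pd i g y" if "y \<in> S" for y
      using pd_cong[OF assms(1) that Suc.prems(1)] by auto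
    show "Ck_on k S (pd i f)" using Suc.prems(2) by simp
  qed
  ultimately show ?case by simp
qed

lemma Ck_on_Suc_imp: "Ck_on (Suc k) S f \<Longrightarrow> Ck_on k S f"
proof (induction k arbitrary: f)
  case 0
  then show ?case
    by (auto intro!: continuous_at_imp_continuous_on differentiable_imp_continuous_within)
next
  case (Suc k)
  then show ?case by (metis Ck_on.simps(2))
qed

lemma Ck_on_const: "Ck_on k S (\<lambda>x. a)"
proof (induction k arbitrary: a)
  case (Suc k)
  have "pd i (\<lambda>x. a) = (\<lambda>x. 0)" for i :: 'a by (intro ext) simp
  with Suc show ?case by simp
qed simp

lemma Ck_on_add:
  assumes "open S" "Ck_on k S f" "Ck_on k S g"
  shows "Ck_on k S (\<lambda>x. f x + g x)"
  using assms(2,3)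
proof (induction k arbitrary: f g)
  case 0 then show ?case by (simp add: continuous_on_add)
next
  case (Suc k)
  have "Ck_on k S (pd i (\<lambda>x. f x + g x))" for i
    by (rule Ck_on_cong[OF assms(1) _ Suc.IH[of "pd i f" "pd i g"]])
      (use Suc.prems in \<open>simp_all add: pd_add\<close>)
  then show ?case using Suc.prems by (simp add: differentiable_add)
qed

lemma Ck_on_mult:
  assumes "open S" "Ck_on k S f" "Ck_on k S g"
  shows "Ck_on k S (\<lambda>x. f x * g x)"
  using assms(2,3)
proof (induction k arbitrary: f g)
  case 0 then show ?case by (simp add: continuous_on_mult)
next
  case (Suc k)
  have "Ck_on k S (pd i (\<lambda>x. f x * g x))" for i
  proof (rule Ck_on_cong[OF assms(1)])
    show "Ck_on k S (\<lambda>x. pd i f x * g x + f x * pd i g x)"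
    proof (rule Ck_on_add[OF assms(1)])
      have f: "Ck_on k S f" and g: "Ck_on k S g" and df: "Ck_on k S (pd i f)" and dg: "Ck_on k S (pd i g)"
        using Suc.prems Ck_on_Suc_imp by auto
      show "Ck_on k S (\<lambda>x. pd i f x * g x)" by (rule Suc.IH[OF df g])
      show "Ck_on k S (\<lambda>x. f x * pd i g x)" by (rule Suc.IH[OF f dg])
    qed
  qed (use Suc.prems in \<open>simp_all add: pd_mult\<close>)
  then show ?case using Suc.prems by (simp add: differentiable_mult)
qed

lemma smooth_on_const: "smooth_on S (\<lambda>x. a)"
  by (simp add: smooth_on_def Ck_on_const)

lemma smooth_on_add:
  "open S \<Longrightarrow> smooth_on S f \<Longrightarrow> smooth_on S g \<Longrightarrow> smooth_on S (\<lambda>x. f x + g x)"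
  by (simp add: smooth_on_def Ck_on_add)

lemma smooth_on_mult:
  "open S \<Longrightarrow> smooth_on S f \<Longrightarrow> smooth_on S g \<Longrightarrow> smooth_on S (\<lambda>x. f x * g x)"
  by (simp add: smooth_on_def Ck_on_mult)

lemma smooth_on_diff:
  assumes "open S" "smooth_on S f" "smooth_on S g"
  shows "smooth_on S (\<lambda>x. f x - g x)"
  using smooth_on_add[OF assms(1,2) smooth_on_mult[OF assms(1) smooth_on_const[of _ "-1"] assms(3)]]
  by simp

lemma smooth_on_sum:
  assumes "open S" "finite I" "\<And>p. p \<in> I \<Longrightarrow> smooth_on S (f p)"
  shows "smooth_on S (\<lambda>x. \<Sum>p\<in>I. f p x)"
  using assms(2,3)
  by (induction I rule: finite_induct) (auto intro: smooth_on_add[OF assms(1)] smooth_on_const)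

lemma smooth_on_pd: "smooth_on S f \<Longrightarrow> smooth_on S (pd i f)"
  unfolding smooth_on_def by (metis Ck_on.simps(2))

lemma smooth_on_differentiable: "smooth_on S f \<Longrightarrow> x \<in> S \<Longrightarrow> f differentiable (at x)"
  unfolding smooth_on_def by (metis Ck_on.simps(2))

lemma smooth_on_pd_commute:
  assumes "open S" "smooth_on S f" "x \<in> S"
  shows "pd i (pd j f) x = pd j (pd i f) x"
  using pd_commute assms unfolding smooth_on_def by blast

lemma pd_chain:
  fixes T :: "real^'n::finite \<Rightarrow> real^'n" and f :: "real^'n \<Rightarrow> real"
  assumes T: "\<And>m. (\<lambda>y. T y $ m) differentiable (at x)" and f: "f differentiable (at (T x))"
  shows "pd i (\<lambda>y. f (T y)) x = (\<Sum>m\<in>UNIV. pd i (\<lambda>y. T y $ m) x * pd m f (T x))"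
    and "(\<lambda>y. f (T y)) differentiable (at x)"
proof -
  let ?D = "\<lambda>v. \<chi> m. frechet_derivative (\<lambda>y. T y $ m) (at x) v"
  have DT: "(T has_derivative ?D) (at x)"
  proof (subst has_derivative_componentwise_within, intro ballI)
    fix b :: "real^'n" assume "b \<in> Basis"
    then obtain m where b: "b = axis m 1" by (auto simp: Basis_vec_def)
    show "((\<lambda>x. T x \<bullet> b) has_derivative (\<lambda>v. ?D v \<bullet> b)) (at x)"
      using pd_works[OF T[of m]] by (simp add: b cart_eq_inner_axis[symmetric])
  qed
  note DfT = has_derivative_compose[OF DT pd_works[OF f]]
  then show "(\<lambda>y. f (T y)) differentiable (at x)" by (auto simp: differentiable_def)
  have "?D (axis i 1) = (\<Sum>m\<in>UNIV. pd i (\<lambda>y. T y $ m) x *\<^sub>R axis m 1)"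
    by (subst (1) basis_expansion[symmetric]) (simp add: pd_def scalar_mult_eq_scaleR)
  then show "pd i (\<lambda>y. f (T y)) x = (\<Sum>m\<in>UNIV. pd i (\<lambda>y. T y $ m) x * pd m f (T x))"
    using linear_frechet_derivative[OF f]
    by (simp add: pd_eqI[OF DfT] linear_sum linear_scale) (simp add: pd_def)
qed

lemma differentiable_prod_real:
  fixes f :: "'b \<Rightarrow> real^'n::finite \<Rightarrow> real"
  assumes "finite I" "\<And>p. p \<in> I \<Longrightarrow> f p differentiable (at x)"
  shows "(\<lambda>y. \<Prod>p\<in>I. f p y) differentiable (at x)"
  using assms by (induction I rule: finite_induct) (auto intro: differentiable_mult)

lemma differentiable_det:
  fixes M :: "real^'n::finite \<Rightarrow> 'k::finite \<Rightarrow> 'k \<Rightarrow> real"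
  assumes "\<And>i j. (\<lambda>y. M y i j) differentiable (at x)"
  shows "(\<lambda>y. det (\<chi> i j. M y i j)) differentiable (at x)"
  unfolding det_def
  by (intro differentiable_sum ballI finite_permutations differentiable_mult differentiable_const)
    (auto intro!: differentiable_prod_real assms)

text \<open>By Cramer's rule each entry of \<open>h\<^sup>-\<^sup>1\<close> is a quotient of determinants whose entries are constants and
  entries of \<open>h\<close>.\<close>

lemma differentiable_ginv:
  fixes h :: "'n::finite tensor2"
  assumes S: "open S" "x \<in> S" and inv: "\<And>y. y \<in> S \<Longrightarrow> invertible (\<chi> i j. h y i j)"
    and D: "\<And>i j. (\<lambda>y. h y i j) differentiable (at x)"
  shows "(\<lambda>y. ginv h y i j) differentiable (at x)"
proof (rule differentiable_cong[OF S])
  define c where "c y = det (\<chi> a b. if b = i then (if a = j then 1 else 0) else h y a b)" for y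
  have d0: "det (\<chi> i j. h y i j) \<noteq> 0" if "y \<in> S" for y
    using inv[OF that] by (simp add: invertible_det_nz)
  show "c y / det (\<chi> i j. h y i j) = ginv h y i j" if "y \<in> S" for y
  proof -
    let ?H = "\<chi> i j. h y i j"
    have "?H *v (\<chi> k. ginv h y k j) = axis j 1"
      using ginv_inverse(2)[where h = h and x = y, OF inv[OF that]]
      by (simp add: vec_eq_iff matrix_vector_mult_def axis_def)
    then have "(\<chi> k. ginv h y k j) =
        (\<chi> k. det (\<chi> a b. if b = k then axis j 1 $ a else ?H $ a $ b) / det ?H)"
      using cramer[OF d0[OF that]] by blast
    then show ?thesis
      by (simp add: vec_eq_iff c_def axis_def cong: if_cong)
  qed
  have "(\<lambda>y. if b = i then if a = j then 1 else 0 else h y a b) differentiable (at x)" for a b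
    by (cases "b = i") (simp_all add: D)
  then have "c differentiable (at x)"
    unfolding c_def by (rule differentiable_det)
  then show "(\<lambda>y. c y / det (\<chi> i j. h y i j)) differentiable (at x)"
    using d0[OF S(2)] by (intro differentiable_divide differentiable_det D)
qed

section \<open>Pseudo-Riemannian metrics in a chart\<close>

definition pairing :: "'n::finite tensor2 \<Rightarrow> real^'n \<Rightarrow> ('n \<Rightarrow> real) \<Rightarrow> ('n \<Rightarrow> real) \<Rightarrow> real" where
  "pairing h x u v = (\<Sum>a\<in>UNIV. \<Sum>b\<in>UNIV. ginv h x a b * (u a * v b))"

lemma pairing_add_left: "pairing h x (\<lambda>a. u a + v a) w = pairing h x u w + pairing h x v w"
  and pairing_add_right: "pairing h x w (\<lambda>a. u a + v a) = pairing h x w u + pairing h x w v"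
  and pairing_diff_right: "pairing h x w (\<lambda>a. u a - v a) = pairing h x w u - pairing h x w v"
  and pairing_scale_left: "pairing h x (\<lambda>a. t * u a) w = t * pairing h x u w"
  and pairing_scale_right: "pairing h x w (\<lambda>a. t * u a) = t * pairing h x w u"
  by (simp_all add: pairing_def algebra_simps sum.distrib sum_subtractf sum_distrib_left)

lemmas pairing_bilinear =
  pairing_add_left pairing_add_right pairing_diff_right pairing_scale_left pairing_scale_right

text \<open>Christoffel symbols of the first kind, the lowered coefficients of the Levi-Civita connection.\<close>

definition christoffel1 :: "'n::finite tensor2 \<Rightarrow> 'n tensor3" where
  "christoffel1 h x i j l =
     (pd i (\<lambda>y. h y j l) x + pd j (\<lambda>y. h y i l) x - pd l (\<lambda>y. h y i j) x) / 2"

lemma kn3_pairing: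
  "kn3 h \<omega> x i j k l = pairing h x (\<omega> x k i) (\<omega> x j l) - pairing h x (\<omega> x k j) (\<omega> x i l)"
  by (simp add: kn3_def pairing_def right_diff_distrib sum_subtractf)

locale metric_chart =
  fixes S :: "(real^'n::finite) set" and h :: "'n tensor2"
  assumes open_S: "open S"
    and smooth_h: "\<And>i j. smooth_on S (\<lambda>x. h x i j)"
    and sym_h: "\<And>x i j. x \<in> S \<Longrightarrow> h x i j = h x j i"
    and nondeg: "\<And>x. x \<in> S \<Longrightarrow> invertible (\<chi> i j. h x i j)"
begin

lemma sym_ginv: "x \<in> S \<Longrightarrow> ginv h x i j = ginv h x j i"
  by (rule ginv_sym[OF nondeg sym_h])

lemma lower_raise: "x \<in> S \<Longrightarrow> (\<Sum>p\<in>UNIV. (\<Sum>q\<in>UNIV. ginv h x p q * u q) * h x p l) = u l"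
proof -
  assume x: "x \<in> S"
  have "(\<Sum>p\<in>UNIV. (\<Sum>q\<in>UNIV. ginv h x p q * u q) * h x p l) =
      (\<Sum>q\<in>UNIV. u q * (\<Sum>p\<in>UNIV. ginv h x q p * h x p l))"
    unfolding sum_distrib_left sum_distrib_right
    by (subst sum.swap) (simp add: sym_ginv[OF x, of _ q for q] ac_simps)
  then show ?thesis by (simp add: ginv_inverse(1)[where h = h and x = x, OF nondeg[OF x]] mult_delta_right)
qed

lemma raise_lower: "x \<in> S \<Longrightarrow> (\<Sum>q\<in>UNIV. ginv h x p q * (\<Sum>m\<in>UNIV. u m * h x m q)) = u p"
proof -
  assume x: "x \<in> S"
  have "(\<Sum>q\<in>UNIV. ginv h x p q * (\<Sum>m\<in>UNIV. u m * h x m q)) =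
      (\<Sum>m\<in>UNIV. u m * (\<Sum>q\<in>UNIV. ginv h x p q * h x q m))"
    unfolding sum_distrib_left sum_distrib_right
    by (subst sum.swap) (simp add: sym_h[OF x, of _ q for q] ac_simps)
  then show ?thesis by (simp add: ginv_inverse(1)[where h = h and x = x, OF nondeg[OF x]] mult_delta_right)
qed

lemma pairing_commute: "x \<in> S \<Longrightarrow> pairing h x u v = pairing h x v u"
  unfolding pairing_def by (subst sum.swap) (simp add: sym_ginv[of x] mult.commute[of "v _"])

text \<open>Contracting an upper index directly or lowering it first and contracting with \<open>h\<^sup>-\<^sup>1\<close> gives the same
  result. With this lemma every quadratic expression in connection coefficients becomes a value of
  \<open>pairing\<close>.\<close>

lemma pairing_lower:
  assumes "x \<in> S"
  shows "pairing h x (\<lambda>l. \<Sum>p\<in>UNIV. v p * h x p l) w = (\<Sum>p\<in>UNIV. v p * w p)"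
proof -
  have "pairing h x w (\<lambda>l. \<Sum>p\<in>UNIV. v p * h x p l) = (\<Sum>p\<in>UNIV. w p * v p)"
    unfolding pairing_def
    by (subst (2) raise_lower[OF assms, of _ v, symmetric]) (simp add: sum_distrib_left ac_simps)
  then show ?thesis by (simp add: pairing_commute[OF assms, of _ w] mult.commute)
qed

lemma lower_last_inject:
  assumes "x \<in> S" "\<And>l. lower_last h Q x i j k l = lower_last h R x i j k l"
  shows "Q x i j k l = R x i j k l"
  using raise_lower[OF assms(1), of l "Q x i j k"] raise_lower[OF assms(1), of l "R x i j k"] assms(2)
  by (simp add: lower_last_def)

lemma rho_lower_last:
  assumes "x \<in> S"
  shows "rho R x i j = (\<Sum>p\<in>UNIV. \<Sum>q\<in>UNIV. ginv h x p q * lower_last h R x p i j q)"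
  unfolding rho_def lower_last_def by (simp add: raise_lower[OF assms])

lemma rho_raise_last:
  assumes "x \<in> S"
  shows "rho (raise_last h Q) x i j = (\<Sum>p\<in>UNIV. \<Sum>q\<in>UNIV. ginv h x p q * Q x p i j q)"
  unfolding rho_def raise_last_def using sym_ginv[OF assms] by (simp add: mult.commute)

lemma trace_metric: "x \<in> S \<Longrightarrow> trace_h h h x = real CARD('n)"
  using ginv_inverse(1)[where h = h and x = x, OF nondeg]
  by (simp add: trace_h_def sym_h[of x _ j for j])

lemma pd_h_sym: "x \<in> S \<Longrightarrow> pd i (\<lambda>y. h y j k) x = pd i (\<lambda>y. h y k j) x"
  by (rule pd_cong[OF open_S]) (auto simp: sym_h)

lemma christoffel1_sym: "x \<in> S \<Longrightarrow> christoffel1 h x i j l = christoffel1 h x j i l"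
  unfolding christoffel1_def using pd_h_sym[of x l i j] by simp

lemma pd_h: "x \<in> S \<Longrightarrow> pd i (\<lambda>y. h y j l) x = christoffel1 h x i j l + christoffel1 h x i l j"
  unfolding christoffel1_def using pd_h_sym[of x i j l] by (simp add: field_simps)

lemma smooth_christoffel1: "smooth_on S (\<lambda>x. christoffel1 h x i j l)"
  unfolding christoffel1_def divide_inverse
  by (intro smooth_on_mult smooth_on_diff smooth_on_add smooth_on_const smooth_on_pd smooth_h open_S)

lemma levi_civita_lower:
  "x \<in> S \<Longrightarrow> (\<Sum>p\<in>UNIV. levi_civita h x i j p * h x p l) = christoffel1 h x i j l"
  using lower_raise[of x "christoffel1 h x i j" l]
  by (simp add: levi_civita_def christoffel1_def sum_divide_distrib)

lemma levi_civita_contract: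
  assumes "x \<in> S"
  shows "(\<Sum>p\<in>UNIV. levi_civita h x i j p * w p) = pairing h x (christoffel1 h x i j) w"
  using pairing_lower[OF assms, of "levi_civita h x i j" w] by (simp add: levi_civita_lower[OF assms])

text \<open>From \<open>\<partial>\<^sub>i \<Gamma>\<^sub>j\<^sub>k\<^sup>p h\<^sub>p\<^sub>l = \<partial>\<^sub>i G\<^sub>j\<^sub>k\<^sub>l - \<Gamma>\<^sub>j\<^sub>k\<^sup>p \<partial>\<^sub>i h\<^sub>p\<^sub>l\<close> by the product rule. The factor \<open>\<partial>\<^sub>i h\<^sub>p\<^sub>l - G\<^sub>i\<^sub>p\<^sub>l\<close> that
  arises is \<open>G'\<^sub>i\<^sub>l\<^sub>p\<close> for the connection \<open>G'\<close> conjugate to \<open>G\<close> with respect to \<open>h\<close>.\<close>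

lemma lower_last_curvature:
  assumes x: "x \<in> S"
    and lower: "\<And>y i j l. y \<in> S \<Longrightarrow> (\<Sum>p\<in>UNIV. \<Gamma> y i j p * h y p l) = G y i j l"
    and sym: "\<And>y i j l. y \<in> S \<Longrightarrow> G y i j l = G y j i l"
    and D: "\<And>i j l. (\<lambda>y. G y i j l) differentiable (at x)"
  shows "lower_last h (curvature \<Gamma>) x i j k l =
      pd i (\<lambda>y. G y j k l) x - pd j (\<lambda>y. G y i k l) x
      - pairing h x (G x j k) (\<lambda>p. pd i (\<lambda>y. h y p l) x - G x i p l)
      + pairing h x (G x i k) (\<lambda>p. pd j (\<lambda>y. h y p l) x - G x j p l)"
proof -
  have raise: "\<Gamma> y i j k = (\<Sum>q\<in>UNIV. ginv h y k q * G y i j q)" if "y \<in> S" for y i j k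
    using raise_lower[OF that, of k "\<Gamma> y i j"] by (simp add: lower[OF that])
  have Dh: "(\<lambda>y. h y i j) differentiable (at x)" for i j
    by (rule smooth_on_differentiable[OF smooth_h x])
  have D\<Gamma>: "(\<lambda>y. \<Gamma> y i j k) differentiable (at x)" for i j k
  proof (rule differentiable_cong[OF open_S x])
    show "(\<lambda>y. \<Sum>q\<in>UNIV. ginv h y k q * G y i j q) differentiable (at x)"
      by (intro differentiable_sum ballI differentiable_mult D finite
          differentiable_ginv[OF open_S x nondeg Dh])
  qed (simp add: raise)
  have sym\<Gamma>: "\<Gamma> x i j k = \<Gamma> x j i k" for i j k
    unfolding raise[OF x] using sym[OF x] by simp
  have pdG: "pd i (\<lambda>y. G y j k l) x =
      (\<Sum>p\<in>UNIV. pd i (\<lambda>y. \<Gamma> y j k p) x * h x p l) + (\<Sum>p\<in>UNIV. \<Gamma> x j k p * pd i (\<lambda>y. h y p l) x)"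
    for i j
    by (subst pd_cong[OF open_S x, of _ "\<lambda>y. \<Sum>p\<in>UNIV. \<Gamma> y j k p * h y p l"])
      (simp_all add: lower pd_sum pd_mult differentiable_mult D\<Gamma> Dh sum.distrib)
  have quad: "(\<Sum>p\<in>UNIV. (\<Sum>q\<in>UNIV. \<Gamma> x i q p * \<Gamma> x j k q) * h x p l) = (\<Sum>q\<in>UNIV. \<Gamma> x j k q * G x i q l)"
    for i j
    unfolding lower[OF x, symmetric] sum_distrib_left sum_distrib_right
    by (subst sum.swap) (simp add: ac_simps)
  have pair: "pairing h x (G x j k) w = (\<Sum>p\<in>UNIV. \<Gamma> x j k p * w p)" for j w
    using pairing_lower[OF x, of "\<Gamma> x j k" w] by (simp add: lower[OF x])
  show ?thesis
    unfolding lower_last_def curvature_eq[OF D\<Gamma> sym\<Gamma>] pdG pair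
    by (simp add: left_diff_distrib right_diff_distrib distrib_right sum.distrib sum_subtractf quad)
qed

lemma Riem_eq:
  assumes x: "x \<in> S"
  shows "Riem h x i j k l =
      pd i (\<lambda>y. christoffel1 h y j k l) x - pd j (\<lambda>y. christoffel1 h y i k l) x
      - pairing h x (christoffel1 h x j k) (christoffel1 h x i l)
      + pairing h x (christoffel1 h x i k) (christoffel1 h x j l)"
  unfolding Riem_def
  by (subst lower_last_curvature[OF x levi_civita_lower christoffel1_sym
        smooth_on_differentiable[OF smooth_christoffel1 x]])
    (simp_all add: pd_h[OF x])

text \<open>In \<open>Riem_eq\<close> the quadratic terms are visibly antisymmetric in \<open>k\<close>, \<open>l\<close>. The symmetric part of the
  derivative terms is \<open>\<partial>\<^sub>i \<partial>\<^sub>j h\<^sub>k\<^sub>l - \<partial>\<^sub>j \<partial>\<^sub>i h\<^sub>k\<^sub>l = 0\<close>.\<close>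

lemma Riem_antisym:
  assumes x: "x \<in> S"
  shows "Riem h x i j l k = - Riem h x i j k l"
proof -
  have "pd i (\<lambda>y. christoffel1 h y j k l) x + pd i (\<lambda>y. christoffel1 h y j l k) x =
      pd i (pd j (\<lambda>y. h y k l)) x" for i j
    using pd_cong[OF open_S x, of "pd j (\<lambda>y. h y k l)"
        "\<lambda>y. christoffel1 h y j k l + christoffel1 h y j l k" i]
    by (simp add: pd_h pd_add smooth_on_differentiable[OF smooth_christoffel1 x])
  from this[of i j] this[of j i] smooth_on_pd_commute[OF open_S smooth_h x, of i j k l]
  show ?thesis
    unfolding Riem_eq[OF x] pairing_commute[OF x, of "christoffel1 h x _ l"] by simp
qed

lemma kn2_antisym: "x \<in> S \<Longrightarrow> kn2 h x i j l k = - kn2 h x i j k l"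
  by (simp add: kn2_def sym_h[of x l] sym_h[of x k] sym_h[of x l k])

lemma rho_kn2:
  assumes x: "x \<in> S"
  shows "(\<Sum>p\<in>UNIV. \<Sum>q\<in>UNIV. ginv h x p q * kn2 h x p i j q) = (1 - real CARD('n)) * h x i j"
proof -
  have a: "(\<Sum>p\<in>UNIV. \<Sum>q\<in>UNIV. ginv h x p q * (h x j p * h x i q)) = h x j i"
    using pairing_lower[OF x, of "\<lambda>p. if p = i then 1 else 0" "h x j"] pairing_commute[OF x, of "h x i" "h x j"]
    by (simp add: mult_delta_left pairing_def)
  have "(\<Sum>p\<in>UNIV. \<Sum>q\<in>UNIV. ginv h x p q * (h x j i * h x p q)) = h x j i * trace_h h h x"
    by (simp add: trace_h_def sum_distrib_left mult.left_commute)
  then show ?thesis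
    unfolding kn2_def right_diff_distrib sum_subtractf a trace_metric[OF x] sym_h[OF x, of i j]
    by (simp add: algebra_simps)
qed

end

section \<open>Deforming the Levi-Civita connection by a symmetric cubic tensor\<close>

locale cubic_chart = metric_chart S h for S and h :: "'n::finite tensor2" +
  fixes \<omega> :: "'n tensor3"
  assumes smooth_\<omega>: "\<And>i j k. smooth_on S (\<lambda>x. \<omega> x i j k)"
    and sym_\<omega>: "\<And>x i j k. x \<in> S \<Longrightarrow> \<omega> x i j k = \<omega> x j i k \<and> \<omega> x i j k = \<omega> x i k j"
begin

abbreviation D\<omega> :: "'n tensor4" where "D\<omega> \<equiv> cov3 (levi_civita h) \<omega>"

definition codazzi :: "'n tensor4" where
  "codazzi x i j k l = D\<omega> x i j k l - D\<omega> x j i k l"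

lemma cov3_eq:
  assumes x: "x \<in> S"
  shows "D\<omega> x i j k l = pd i (\<lambda>y. \<omega> y j k l) x
     - pairing h x (christoffel1 h x i j) (\<omega> x k l)
     - pairing h x (christoffel1 h x i k) (\<omega> x j l)
     - pairing h x (christoffel1 h x i l) (\<omega> x j k)"
proof -
  have "\<omega> x p k l = \<omega> x k l p" "\<omega> x j p l = \<omega> x j l p" for j k l p
    using sym_\<omega>[OF x] by metis+
  then have "(\<lambda>p. \<omega> x p k l) = \<omega> x k l" "(\<lambda>p. \<omega> x j p l) = \<omega> x j l" for j k l
    by blast+
  then show ?thesis
    by (simp add: cov3_def levi_civita_contract[OF x])
qed

lemma cov3_sym:
  assumes x: "x \<in> S"
  shows "D\<omega> x i j k l = D\<omega> x i j l k"
proof -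
  have "pd i (\<lambda>y. \<omega> y j k l) x = pd i (\<lambda>y. \<omega> y j l k) x"
    using sym_\<omega> by (intro pd_cong[OF open_S x]) metis
  moreover have "\<omega> x k l = \<omega> x l k" using sym_\<omega>[OF x] by blast
  ultimately show ?thesis unfolding cov3_eq[OF x] by simp
qed

lemma codazzi_sym: "x \<in> S \<Longrightarrow> codazzi x i j l k = codazzi x i j k l"
  by (simp add: codazzi_def cov3_sym[of x _ _ l k])

text \<open>Exchanging the two pairs of contracted indices, \<open>(i, j)\<close> and \<open>(p, q)\<close>, and using the symmetry of
  \<open>D\<^sub>i \<omega>\<^sub>p\<^sub>j\<^sub>q\<close> in \<open>j\<close>, \<open>q\<close> turns one half of the Codazzi expression into the other.\<close>

lemma codazzi_double_trace:
  assumes x: "x \<in> S"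
  shows "(\<Sum>i\<in>UNIV. \<Sum>j\<in>UNIV. ginv h x i j *
      (\<Sum>p\<in>UNIV. \<Sum>q\<in>UNIV. ginv h x p q * codazzi x p i j q)) = 0"
proof -
  let ?T = "\<lambda>F. \<Sum>i\<in>UNIV. \<Sum>j\<in>UNIV. \<Sum>p\<in>UNIV. \<Sum>q\<in>UNIV. ginv h x i j * (ginv h x p q * F p i j q)"
  have "?T (\<lambda>p i j q. D\<omega> x i p j q) = (\<Sum>i\<in>UNIV. \<Sum>p\<in>UNIV. \<Sum>j\<in>UNIV. \<Sum>q\<in>UNIV. ginv h x i j * (ginv h x p q * D\<omega> x i p j q))"
    by (intro sum.cong refl sum.swap)
  also have "\<dots> = (\<Sum>i\<in>UNIV. \<Sum>p\<in>UNIV. \<Sum>q\<in>UNIV. \<Sum>j\<in>UNIV. ginv h x i j * (ginv h x p q * D\<omega> x i p j q))"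
    by (intro sum.cong refl sum.swap)
  also have "\<dots> = (\<Sum>p\<in>UNIV. \<Sum>i\<in>UNIV. \<Sum>q\<in>UNIV. \<Sum>j\<in>UNIV. ginv h x i j * (ginv h x p q * D\<omega> x i p j q))"
    by (rule sum.swap)
  also have "\<dots> = (\<Sum>p\<in>UNIV. \<Sum>q\<in>UNIV. \<Sum>i\<in>UNIV. \<Sum>j\<in>UNIV. ginv h x i j * (ginv h x p q * D\<omega> x i p j q))"
    by (intro sum.cong refl sum.swap)
  also have "\<dots> = ?T (\<lambda>p i j q. D\<omega> x p i j q)"
    by (simp add: cov3_sym[OF x, of _ _ _ q for q] mult.left_commute)
  finally show ?thesis
    by (simp add: codazzi_def sum_distrib_left right_diff_distrib sum_subtractf)
qed

lemma kn3_antisym: "x \<in> S \<Longrightarrow> kn3 h \<omega> x i j l k = - kn3 h \<omega> x i j k l"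
proof -
  assume x: "x \<in> S"
  have "\<omega> x j k = \<omega> x k j" for j k using sym_\<omega>[OF x] by blast
  then show ?thesis
    unfolding kn3_pairing using pairing_commute[OF x, of "\<omega> x l i" "\<omega> x j k"]
      pairing_commute[OF x, of "\<omega> x l j" "\<omega> x i k"] by simp
qed

text \<open>Since \<open>\<partial>\<^sub>i h\<^sub>p\<^sub>l = C\<^sub>i\<^sub>p\<^sub>l + C\<^sub>i\<^sub>l\<^sub>p\<close>, the conjugate of \<open>C + t \<omega>\<close> is \<open>C - t \<omega>\<close>, so the quadratic terms are
  \<open>\<langle>C\<^sub>i\<^sub>k + t \<omega>\<^sub>i\<^sub>k, C\<^sub>j\<^sub>l - t \<omega>\<^sub>j\<^sub>l\<rangle>\<close> antisymmetrised in \<open>i\<close>, \<open>j\<close>. Their parts linear in \<open>t\<close> are the correction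
  terms of the covariant derivative \<open>D\<omega>\<close>.\<close>

lemma lower_last_curvature_deformation:
  assumes x: "x \<in> S"
    and lower: "\<And>y i j l. y \<in> S \<Longrightarrow>
      (\<Sum>p\<in>UNIV. \<Gamma> y i j p * h y p l) = christoffel1 h y i j l + t * \<omega> y i j l"
  shows "lower_last h (curvature \<Gamma>) x i j k l =
    Riem h x i j k l + t * codazzi x i j k l - t\<^sup>2 * kn3 h \<omega> x i j k l"
proof -
  note DC = smooth_on_differentiable[OF smooth_christoffel1 x]
  note D = smooth_on_differentiable[OF smooth_\<omega> x]
  have sw: "\<omega> x j k = \<omega> x k j" "\<omega> x j p l = \<omega> x j l p" for j k p l using sym_\<omega>[OF x] by blast+
  have res: "lower_last h (curvature \<Gamma>) x i j k l =
      pd i (\<lambda>y. christoffel1 h y j k l + t * \<omega> y j k l) x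
      - pd j (\<lambda>y. christoffel1 h y i k l + t * \<omega> y i k l) x
      - pairing h x (\<lambda>p. christoffel1 h x j k p + t * \<omega> x j k p)
          (\<lambda>p. christoffel1 h x i l p - t * \<omega> x i l p)
      + pairing h x (\<lambda>p. christoffel1 h x i k p + t * \<omega> x i k p)
          (\<lambda>p. christoffel1 h x j l p - t * \<omega> x j l p)"
    by (subst lower_last_curvature[OF x lower])
      (use sym_\<omega> in \<open>simp_all add: christoffel1_sym[of _ i j for i j] DC D pd_h[OF x] sw(2)[of _ _ l]
         differentiable_add differentiable_mult\<close>)
  have sC: "christoffel1 h x j i = christoffel1 h x i j"
    using christoffel1_sym[OF x] by blast
  show ?thesis
    unfolding res codazzi_def cov3_eq[OF x] Riem_eq[OF x] kn3_pairing
    by (simp add: pairing_bilinear pd_add pd_mult DC D differentiable_mult sC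
        sw(1)[of k] pairing_commute[OF x, of "\<omega> x _ _" "christoffel1 h x _ _"] algebra_simps power2_eq_square)
qed


lemma rho_deformation:
  assumes x: "x \<in> S"
    and lower: "\<And>y i j l. y \<in> S \<Longrightarrow>
      (\<Sum>p\<in>UNIV. \<Gamma> y i j p * h y p l) = christoffel1 h y i j l + t * \<omega> y i j l"
  shows "rho (curvature \<Gamma>) x i j = Ric h x i j
    + t * (\<Sum>p\<in>UNIV. \<Sum>q\<in>UNIV. ginv h x p q * codazzi x p i j q)
    - t\<^sup>2 * rho (raise_last h (kn3 h \<omega>)) x i j"
proof -
  have "Ric h x i j = (\<Sum>p\<in>UNIV. \<Sum>q\<in>UNIV. ginv h x p q * Riem h x p i j q)"
    unfolding Ric_def Riem_def by (rule rho_lower_last[OF x])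
  moreover have "lower_last h (curvature \<Gamma>) x i j k l =
      Riem h x i j k l + t * codazzi x i j k l - t\<^sup>2 * kn3 h \<omega> x i j k l" for i j k l
    by (rule lower_last_curvature_deformation[OF x lower])
  ultimately show ?thesis
    unfolding rho_raise_last[OF x] rho_lower_last[OF x, of "curvature \<Gamma>"]
    by (simp add: distrib_left right_diff_distrib sum.distrib sum_subtractf sum_distrib_left mult.left_commute)
qed

text \<open>In the trace of \<open>\<omega> \<circledast> \<omega>\<close> the terms containing \<open>h\<^sup>p\<^sup>q \<omega>\<^sub>p\<^sub>q\<^sub>b\<close> drop out; the rest is \<open>|\<omega>|\<^sup>2\<close> with the contracted
  indices in another order.\<close>

lemma trace_rho_kn3:
  assumes x: "x \<in> S"
    and tracefree: "\<And>i. (\<Sum>j\<in>UNIV. \<Sum>k\<in>UNIV. ginv h x j k * \<omega> x i j k) = 0"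
  shows "trace_h h (rho (raise_last h (kn3 h \<omega>))) x = norm2 h \<omega> x"
proof -
  let ?P = "\<lambda>i a. \<Sum>j\<in>UNIV. \<Sum>b\<in>UNIV. ginv h x j b * pairing h x (\<omega> x i j) (\<omega> x a b)"
  have "(\<Sum>p\<in>UNIV. \<Sum>q\<in>UNIV. ginv h x p q * pairing h x u (\<omega> x p q)) = 0" for u
  proof -
    have "(\<Sum>p\<in>UNIV. \<Sum>q\<in>UNIV. ginv h x p q * pairing h x u (\<omega> x p q)) =
        pairing h x u (\<lambda>b. \<Sum>p\<in>UNIV. \<Sum>q\<in>UNIV. ginv h x p q * \<omega> x p q b)"
    proof -
      have "pairing h x u (\<lambda>b. \<Sum>q\<in>I. F q b) = (\<Sum>q\<in>I. pairing h x u (F q))"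
        if "finite I" for I :: "'n set" and F
        using that
        by (induction I rule: finite_induct)
          (simp_all add: pairing_add_right, simp add: pairing_def)
      then show ?thesis by (simp add: pairing_scale_right)
    qed
    also have "(\<lambda>b. \<Sum>p\<in>UNIV. \<Sum>q\<in>UNIV. ginv h x p q * \<omega> x p q b) = (\<lambda>b. 0)"
    proof -
      have "\<omega> x p q b = \<omega> x b p q" for p q b using sym_\<omega>[OF x] by metis
      then show ?thesis by (simp add: tracefree)
    qed
    finally show ?thesis by (simp add: pairing_def)
  qed
  then have "rho (raise_last h (kn3 h \<omega>)) x i j = ?P j i" for i j
    unfolding rho_raise_last[OF x] kn3_pairing by (simp add: right_diff_distrib sum_subtractf)
  then have "trace_h h (rho (raise_last h (kn3 h \<omega>))) x = (\<Sum>i\<in>UNIV. \<Sum>a\<in>UNIV. ginv h x i a * ?P i a)"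
    unfolding trace_h_def by (subst sum.swap) (simp add: sym_ginv[OF x])
  also have "\<dots> = (\<Sum>i\<in>UNIV. \<Sum>a\<in>UNIV. \<Sum>j\<in>UNIV. \<Sum>b\<in>UNIV. \<Sum>k\<in>UNIV. \<Sum>c\<in>UNIV.
      ginv h x i a * ginv h x j b * ginv h x k c * \<omega> x a b c * \<omega> x i j k)"
    by (simp add: pairing_def sum_distrib_left ac_simps)
  also have "\<dots> = (\<Sum>i\<in>UNIV. \<Sum>j\<in>UNIV. \<Sum>a\<in>UNIV. \<Sum>k\<in>UNIV. \<Sum>b\<in>UNIV. \<Sum>c\<in>UNIV.
      ginv h x i a * ginv h x j b * ginv h x k c * \<omega> x a b c * \<omega> x i j k)"
    by (subst (2) sum.swap) (intro sum.cong refl sum.swap)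
  also have "\<dots> = norm2 h \<omega> x"
    unfolding norm2_def by (intro sum.cong refl sum.swap)
  finally show ?thesis .
qed

lemma scalar_deformation:
  assumes x: "x \<in> S"
    and lower: "\<And>y i j l. y \<in> S \<Longrightarrow>
      (\<Sum>p\<in>UNIV. \<Gamma> y i j p * h y p l) = christoffel1 h y i j l + t * \<omega> y i j l"
    and tracefree: "\<And>i. (\<Sum>j\<in>UNIV. \<Sum>k\<in>UNIV. ginv h x j k * \<omega> x i j k) = 0"
  shows "scalar_curvature \<Gamma> h x = scal h x - t\<^sup>2 * norm2 h \<omega> x"
proof -
  let ?c = "\<lambda>i j. \<Sum>p\<in>UNIV. \<Sum>q\<in>UNIV. ginv h x p q * codazzi x p i j q"
  have "rho (curvature \<Gamma>) x i j =
      Ric h x i j + t * ?c i j - t\<^sup>2 * rho (raise_last h (kn3 h \<omega>)) x i j" for i j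
    by (rule rho_deformation[OF x lower])
  then have "scalar_curvature \<Gamma> h x = scal h x + t * (\<Sum>i\<in>UNIV. \<Sum>j\<in>UNIV. ginv h x i j * ?c i j)
      - t\<^sup>2 * trace_h h (rho (raise_last h (kn3 h \<omega>))) x"
    unfolding scalar_curvature_def scal_def trace_h_def
    by (simp add: distrib_left right_diff_distrib sum.distrib sum_subtractf mult.left_commute[of _ t]
        mult.left_commute[of _ "t\<^sup>2"] sum_distrib_left[symmetric])
  then show ?thesis by (simp add: codazzi_double_trace[OF x] trace_rho_kn3[OF x tracefree])
qed

end

section \<open>Conjugate pairs of connections in a chart\<close>

text \<open>The connection and its conjugate enter only through their lowered coefficients, which places them at
  \<open>t = -1/2\<close> and \<open>t = 1/2\<close> in the family of deformations. The definition of \<open>conjugate\<close>, which refers to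
  an atlas, is thereby kept out of the computations in a chart.\<close>

locale statistical_chart = cubic_chart S h L
  for S and h :: "'n::finite tensor2" and L :: "'n tensor3" +
  fixes \<Gamma> \<Gamma>' :: "'n tensor3"
  assumes lower_\<Gamma>: "\<And>x i j l. x \<in> S \<Longrightarrow>
      (\<Sum>p\<in>UNIV. \<Gamma> x i j p * h x p l) = christoffel1 h x i j l + (- (1 / 2)) * L x i j l"
    and lower_\<Gamma>': "\<And>x i j l. x \<in> S \<Longrightarrow>
      (\<Sum>p\<in>UNIV. \<Gamma>' x i j p * h x p l) = christoffel1 h x i j l + 1 / 2 * L x i j l"
    and tracefree: "\<And>x i. x \<in> S \<Longrightarrow> (\<Sum>j\<in>UNIV. \<Sum>k\<in>UNIV. ginv h x j k * L x i j k) = 0"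
begin

lemma curvature_lower:
  assumes x: "x \<in> S"
  shows "lower_last h (curvature \<Gamma>) x i j k l =
      Riem h x i j k l - codazzi x i j k l / 2 - kn3 h L x i j k l / 4"
    and "lower_last h (curvature \<Gamma>') x i j k l =
      Riem h x i j k l + codazzi x i j k l / 2 - kn3 h L x i j k l / 4"
  using lower_last_curvature_deformation[OF x lower_\<Gamma>] lower_last_curvature_deformation[OF x lower_\<Gamma>']
  by (simp_all add: power2_eq_square)

lemma self_conjugate_iff_codazzi:
  assumes x: "x \<in> S"
  shows "(\<forall>i j k l. curvature \<Gamma> x i j k l = curvature \<Gamma>' x i j k l) \<longleftrightarrow>
    (\<forall>i j k l. codazzi x i j k l = 0)"
proof safe
  fix i j k l assume "\<forall>i j k l. curvature \<Gamma> x i j k l = curvature \<Gamma>' x i j k l"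
  then have "lower_last h (curvature \<Gamma>) x i j k l = lower_last h (curvature \<Gamma>') x i j k l"
    by (simp add: lower_last_def)
  then show "codazzi x i j k l = 0" by (simp add: curvature_lower[OF x])
next
  fix i j k l assume "\<forall>i j k l. codazzi x i j k l = 0"
  then have "lower_last h (curvature \<Gamma>) x i j k m = lower_last h (curvature \<Gamma>') x i j k m" for m
    by (simp add: curvature_lower[OF x])
  from lower_last_inject[OF x this]
  show "curvature \<Gamma> x i j k l = curvature \<Gamma>' x i j k l" .
qed

lemma scalar_curvature_eq:
  assumes x: "x \<in> S"
  shows "scalar_curvature \<Gamma> h x = scal h x - 1 / 4 * norm2 h L x"
proof -
  have "scalar_curvature \<Gamma> h x = scal h x - (- (1 / 2))\<^sup>2 * norm2 h L x"
    by (rule scalar_deformation[OF x lower_\<Gamma> tracefree[OF x]])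
  then show ?thesis by (simp add: power2_eq_square)
qed

lemma rho_codazzi:
  assumes x: "x \<in> S" and "\<forall>i j k l. codazzi x i j k l = 0"
  shows "rho (curvature \<Gamma>) x i j = Ric h x i j - 1 / 4 * rho (raise_last h (kn3 h L)) x i j"
proof -
  have "rho (curvature \<Gamma>) x i j = Ric h x i j
      + (- (1 / 2)) * (\<Sum>p\<in>UNIV. \<Sum>q\<in>UNIV. ginv h x p q * codazzi x p i j q)
      - (- (1 / 2))\<^sup>2 * rho (raise_last h (kn3 h L)) x i j"
    by (rule rho_deformation[OF x lower_\<Gamma>])
  then show ?thesis using assms(2) by (simp add: power2_eq_square)
qed

text \<open>As \<open>h \<circledast> h\<close> is antisymmetric in \<open>k\<close>, \<open>l\<close>, so is \<open>R\<close>; but \<open>R\<^sub>i\<^sub>j\<^sub>k\<^sub>l + R\<^sub>i\<^sub>j\<^sub>l\<^sub>k\<close> is minus the Codazzi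
  expression. The value of \<open>r\<close> is the double trace of \<open>\<alpha> h \<circledast> h\<close>.\<close>

lemma constant_curvature_at:
  assumes x: "x \<in> S"
    and const: "\<forall>i j k l. lower_last h (curvature \<Gamma>) x i j k l = \<alpha> * kn2 h x i j k l"
  shows "\<forall>i j k l. codazzi x i j k l = 0"
    and "scalar_curvature \<Gamma> h x = - (real CARD('n) * (real CARD('n) - 1)) * \<alpha>"
proof -
  show "\<forall>i j k l. codazzi x i j k l = 0"
  proof safe
    fix i j k l
    have "Riem h x i j k l - codazzi x i j k l / 2 - kn3 h L x i j k l / 4 = \<alpha> * kn2 h x i j k l"
      "Riem h x i j l k - codazzi x i j l k / 2 - kn3 h L x i j l k / 4 = \<alpha> * kn2 h x i j l k"
      using const by (simp_all add: curvature_lower[OF x])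
    then show "codazzi x i j k l = 0"
      by (simp add: Riem_antisym[OF x, of i j l k] kn2_antisym[OF x, of i j l k]
          kn3_antisym[OF x, of i j l k] codazzi_sym[OF x, of i j l k])
  qed
  have "rho (curvature \<Gamma>) x i j = \<alpha> * ((1 - real CARD('n)) * h x i j)" for i j
    unfolding rho_kn2[OF x, symmetric] rho_lower_last[OF x]
    using const by (simp add: sum_distrib_left mult.left_commute)
  then have "scalar_curvature \<Gamma> h x = \<alpha> * (1 - real CARD('n)) * trace_h h h x"
    unfolding scalar_curvature_def trace_h_def by (simp add: sum_distrib_left ac_simps)
  then show "scalar_curvature \<Gamma> h x = - (real CARD('n) * (real CARD('n) - 1)) * \<alpha>"
    by (simp add: trace_metric[OF x] algebra_simps)
qed

text \<open>Tracing \<open>\<rho>(R) = f h\<close> gives \<open>f = r/n\<close>. Then the two equations agree term by term, because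
  \<open>scal = r + |L|\<^sup>2/4\<close> cancels the norm and leaves \<open>r/2 - (n-2)r/(2n) = r/n\<close>.\<close>

lemma einstein_at_iff:
  assumes x: "x \<in> S" and cod: "\<forall>i j k l. codazzi x i j k l = 0"
  shows "(\<exists>f. \<forall>i j. rho (curvature \<Gamma>) x i j = f * h x i j) \<longleftrightarrow>
    (\<forall>i j. Ric h x i j - 1 / 2 * scal h x * h x i j
        + (real CARD('n) - 2) / (2 * real CARD('n)) * scalar_curvature \<Gamma> h x * h x i j =
      1 / 4 * (rho (raise_last h (kn3 h L)) x i j - 1 / 2 * norm2 h L x * h x i j))"
    (is "?E \<longleftrightarrow> (\<forall>i j. ?C i j)")
proof -
  let ?n = "real CARD('n)" and ?r = "scalar_curvature \<Gamma> h x"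
  have "?E \<longleftrightarrow> (\<forall>i j. rho (curvature \<Gamma>) x i j = ?r / ?n * h x i j)"
  proof
    assume ?E
    then obtain f where f: "\<And>i j. rho (curvature \<Gamma>) x i j = f * h x i j" by blast
    have "?r = f * trace_h h h x"
      unfolding scalar_curvature_def trace_h_def f by (simp add: sum_distrib_left ac_simps)
    then have "f = ?r / ?n" by (simp add: trace_metric[OF x])
    then show "\<forall>i j. rho (curvature \<Gamma>) x i j = ?r / ?n * h x i j" using f by simp
  qed blast
  also have "\<dots> \<longleftrightarrow> (\<forall>i j. ?C i j)"
  proof (intro iff_allI)
    fix i j
    have s: "scal h x = ?r + 1 / 4 * norm2 h L x"
      using scalar_curvature_eq[OF x] by simp
    have n: "(?n - 2) / (2 * ?n) = 1 / 2 - 1 / ?n" by (simp add: field_simps)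
    have transfer: "a = b \<longleftrightarrow> c = d" if "a - b = c - d" for a b c d :: real
      using that by auto
    show "rho (curvature \<Gamma>) x i j = ?r / ?n * h x i j \<longleftrightarrow> ?C i j"
      unfolding rho_codazzi[OF x cod] s n by (rule transfer) (simp add: algebra_simps)
  qed
  finally show ?thesis .
qed

end

section \<open>The cubic form as a tensor field\<close>

lemma open_overlap:
  assumes A: "smooth_atlas A" "c \<in> A" "d \<in> A"
  shows "open (overlap c d)"
proof -
  have c: "open (fst c)" "open (coords c)"
    "homeomorphism (fst c) (coords c) (snd c) (inv_into (fst c) (snd c))" and d: "open (fst d)"
    using A unfolding smooth_atlas_def by blast+
  have "openin (top_of_set (coords c)) (overlap c d)"
    unfolding overlap_def
    by (rule homeomorphism_imp_open_map[OF c(3)]) (simp add: c d openin_open_eq open_Int)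
  then show ?thesis using c(2) openin_open_trans by blast
qed

lemma overlap_subset_coords: "overlap c d \<subseteq> coords c"
  by (auto simp: overlap_def coords_def)

lemma transition_in_coords:
  assumes A: "smooth_atlas A" "c \<in> A" and x: "x \<in> overlap c d"
  shows "transition c d x \<in> coords d"
proof -
  from x obtain m where m: "m \<in> fst c" "m \<in> fst d" "x = snd c m" by (auto simp: overlap_def)
  have "inv_into (fst c) (snd c) x = m"
    using A m unfolding smooth_atlas_def homeomorphism_def by blast
  then show ?thesis using m by (simp add: transition_def coords_def)
qed

text \<open>Differentiating \<open>h\<^sub>i\<^sub>j = J\<^sub>i\<^sup>p J\<^sub>j\<^sup>q H\<^sub>p\<^sub>q\<close> produces second derivatives of the transition map, and the
  transformation law of the connection replaces \<open>\<partial>\<^sub>k J\<^sub>i\<^sup>p\<close> by \<open>\<Gamma>\<^sub>k\<^sub>i\<^sup>m J\<^sub>m\<^sup>p - J\<^sub>k\<^sup>a J\<^sub>i\<^sup>b \<Gamma>\<^sub>a\<^sub>b\<^sup>p\<close>. The first term is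
  the correction in \<open>\<nabla>h\<close> on the left, the second that on the right.\<close>

lemma cov2_metric_transform:
  fixes A :: "('m::{t2_space,second_countable_topology}, 'n::finite) chart set"
  assumes A: "smooth_atlas A" "c \<in> A" "d \<in> A" and h: "metric_field A h" and \<Gamma>: "affine_connection A \<Gamma>"
    and x: "x \<in> overlap c d"
  shows "cov2 (\<Gamma> c) (h c) x k i j = (\<Sum>p\<in>UNIV. \<Sum>q\<in>UNIV. \<Sum>r\<in>UNIV.
    jac c d x k p * jac c d x i q * jac c d x j r * cov2 (\<Gamma> d) (h d) (transition c d x) p q r)"
proof -
  let ?T = "transition c d"
  define J where "J i p = jac c d x i p" for i p
  define H where "H p q = h d (?T x) p q" for p q
  define dH where "dH m p q = pd m (\<lambda>y. h d y p q) (?T x)" for m p q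
  define G where "G i j k = \<Gamma> d (?T x) i j k" for i j k
  define dJ where "dJ k i p = pd k (\<lambda>y. jac c d y i p) x" for k i p
  note ov = open_overlap[OF A]
  have Tx: "?T x \<in> coords d" by (rule transition_in_coords[OF A(1,2) x])
  have sT: "smooth_on (overlap c d) (\<lambda>y. ?T y $ m)" for m
    using A unfolding smooth_atlas_def by blast
  have DT: "(\<lambda>y. ?T y $ m) differentiable (at x)" for m
    by (rule smooth_on_differentiable[OF sT x])
  have "smooth_on (overlap c d) (\<lambda>y. jac c d y i p)" for i p
    unfolding jac_def by (rule smooth_on_pd[OF sT])
  then have DJ: "(\<lambda>y. jac c d y i p) differentiable (at x)" for i p
    by (rule smooth_on_differentiable[OF _ x])
  have "(\<lambda>y. h d y p q) differentiable (at (?T x))" for p q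
    using h A Tx smooth_on_differentiable unfolding metric_field_def by blast
  note hT = pd_chain[of ?T, OF DT this]
  have Hs: "H p q = H q p" for p q
    using h A Tx unfolding metric_field_def H_def by blast
  have hs: "h c x p q = h c x q p" for p q
    using h A x overlap_subset_coords unfolding metric_field_def by blast
  have law: "h c y i j = (\<Sum>p\<in>UNIV. \<Sum>q\<in>UNIV. jac c d y i p * jac c d y j q * h d (?T y) p q)"
    if "y \<in> overlap c d" for y i j
    using h A that unfolding metric_field_def by blast
  have lawx: "h c x i j = (\<Sum>p\<in>UNIV. \<Sum>q\<in>UNIV. J i p * J j q * H p q)" for i j
    using law[OF x] by (simp add: J_def H_def)
  have dJ: "dJ k i p = (\<Sum>m\<in>UNIV. \<Gamma> c x k i m * J m p)
      - (\<Sum>a\<in>UNIV. \<Sum>b\<in>UNIV. J k a * J i b * G a b p)" for k i p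
    using \<Gamma> A x unfolding affine_connection_def J_def dJ_def G_def by (simp add: algebra_simps)
  have deriv: "pd k (\<lambda>y. h c y i j) x = (\<Sum>p\<in>UNIV. \<Sum>q\<in>UNIV. dJ k i p * J j q * H p q)
      + (\<Sum>p\<in>UNIV. \<Sum>q\<in>UNIV. J i p * dJ k j q * H p q)
      + (\<Sum>p\<in>UNIV. \<Sum>q\<in>UNIV. J i p * J j q * (\<Sum>m\<in>UNIV. J k m * dH m p q))"
  proof -
    have "pd k (\<lambda>y. h c y i j) x = 
        pd k (\<lambda>y. \<Sum>p\<in>UNIV. \<Sum>q\<in>UNIV. jac c d y i p * jac c d y j q * h d (?T y) p q) x"
      by (rule pd_cong[OF ov x law])
    also have "\<dots> = (\<Sum>p\<in>UNIV. \<Sum>q\<in>UNIV. (dJ k i p * J j q + J i p * dJ k j q) * H p q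
        + J i p * J j q * (\<Sum>m\<in>UNIV. J k m * dH m p q))"
      by (simp add: pd_sum pd_mult differentiable_sum differentiable_mult DJ hT
          J_def H_def dJ_def dH_def jac_def[symmetric])
    finally show ?thesis by (simp add: distrib_right sum.distrib)
  qed
  have rotate: "(\<Sum>p\<in>UNIV. \<Sum>q\<in>UNIV. \<Sum>m\<in>UNIV. F p q m) = (\<Sum>m\<in>UNIV. \<Sum>p\<in>UNIV. \<Sum>q\<in>UNIV. F p q m)"
    for F :: "'n \<Rightarrow> 'n \<Rightarrow> 'n \<Rightarrow> real"
  proof -
    have "(\<Sum>p\<in>UNIV. \<Sum>q\<in>UNIV. \<Sum>m\<in>UNIV. F p q m) = (\<Sum>p\<in>UNIV. \<Sum>m\<in>UNIV. \<Sum>q\<in>UNIV. F p q m)"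
      by (intro sum.cong refl sum.swap)
    also have "\<dots> = (\<Sum>m\<in>UNIV. \<Sum>p\<in>UNIV. \<Sum>q\<in>UNIV. F p q m)" by (rule sum.swap)
    finally show ?thesis .
  qed
  \<comment> \<open>the contribution of one slot of \<open>h\<close>; the other slot follows by the symmetry of \<open>H\<close>\<close>
  have slot: "(\<Sum>p\<in>UNIV. \<Sum>q\<in>UNIV. dJ k i p * J j q * H p q) = (\<Sum>m\<in>UNIV. \<Gamma> c x k i m * h c x m j)
      - (\<Sum>a\<in>UNIV. \<Sum>b\<in>UNIV. \<Sum>q\<in>UNIV. J k a * J i b * J j q * (\<Sum>p\<in>UNIV. G a b p * H p q))" for i j
  proof -
    have "(\<Sum>p\<in>UNIV. \<Sum>q\<in>UNIV. (\<Sum>m\<in>UNIV. \<Gamma> c x k i m * J m p) * J j q * H p q) =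
        (\<Sum>p\<in>UNIV. \<Sum>q\<in>UNIV. \<Sum>m\<in>UNIV. \<Gamma> c x k i m * (J m p * J j q * H p q))"
      by (simp add: sum_distrib_right mult.assoc)
    also have "\<dots> = (\<Sum>m\<in>UNIV. \<Sum>p\<in>UNIV. \<Sum>q\<in>UNIV. \<Gamma> c x k i m * (J m p * J j q * H p q))"
      by (rule rotate)
    also have "\<dots> = (\<Sum>m\<in>UNIV. \<Gamma> c x k i m * h c x m j)"
      by (simp add: lawx sum_distrib_left)
    finally have 1: "(\<Sum>p\<in>UNIV. \<Sum>q\<in>UNIV. (\<Sum>m\<in>UNIV. \<Gamma> c x k i m * J m p) * J j q * H p q) =
        (\<Sum>m\<in>UNIV. \<Gamma> c x k i m * h c x m j)" .
    have "(\<Sum>p\<in>UNIV. \<Sum>q\<in>UNIV. (\<Sum>a\<in>UNIV. \<Sum>b\<in>UNIV. J k a * J i b * G a b p) * J j q * H p q) =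
        (\<Sum>p\<in>UNIV. \<Sum>q\<in>UNIV. \<Sum>a\<in>UNIV. \<Sum>b\<in>UNIV. J k a * J i b * J j q * (G a b p * H p q))"
      by (simp add: sum_distrib_left sum_distrib_right ac_simps)
    also have "\<dots> = (\<Sum>a\<in>UNIV. \<Sum>p\<in>UNIV. \<Sum>q\<in>UNIV. \<Sum>b\<in>UNIV. J k a * J i b * J j q * (G a b p * H p q))"
      by (rule rotate)
    also have "\<dots> = (\<Sum>a\<in>UNIV. \<Sum>b\<in>UNIV. \<Sum>p\<in>UNIV. \<Sum>q\<in>UNIV. J k a * J i b * J j q * (G a b p * H p q))"
      by (rule sum.cong[OF refl rotate])
    also have "\<dots> = (\<Sum>a\<in>UNIV. \<Sum>b\<in>UNIV. \<Sum>q\<in>UNIV. \<Sum>p\<in>UNIV. J k a * J i b * J j q * (G a b p * H p q))"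
      by (intro sum.cong refl sum.swap)
    finally show ?thesis
      unfolding dJ using 1 by (simp add: left_diff_distrib sum_subtractf sum_distrib_left)
  qed
  have slot1: "(\<Sum>p\<in>UNIV. \<Sum>q\<in>UNIV. J i p * dJ k j q * H p q) =
      (\<Sum>p\<in>UNIV. \<Sum>q\<in>UNIV. dJ k j p * J i q * H p q)"
    by (subst sum.swap) (simp add: Hs mult.commute)
  have slot2: "(\<Sum>a\<in>UNIV. \<Sum>b\<in>UNIV. \<Sum>q\<in>UNIV. J k a * J j b * J i q * (\<Sum>p\<in>UNIV. G a b p * H p q)) =
      (\<Sum>a\<in>UNIV. \<Sum>b\<in>UNIV. \<Sum>q\<in>UNIV. J k a * J i b * J j q * (\<Sum>p\<in>UNIV. G a q p * H b p))"
  proof (rule sum.cong[OF refl])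
    fix a
    show "(\<Sum>b\<in>UNIV. \<Sum>q\<in>UNIV. J k a * J j b * J i q * (\<Sum>p\<in>UNIV. G a b p * H p q)) =
      (\<Sum>b\<in>UNIV. \<Sum>q\<in>UNIV. J k a * J i b * J j q * (\<Sum>p\<in>UNIV. G a q p * H b p))"
      by (subst sum.swap) (simp add: Hs[of _ b for b] ac_simps)
  qed
  have slot3: "(\<Sum>p\<in>UNIV. \<Sum>q\<in>UNIV. J i p * J j q * (\<Sum>m\<in>UNIV. J k m * dH m p q)) =
      (\<Sum>a\<in>UNIV. \<Sum>b\<in>UNIV. \<Sum>q\<in>UNIV. J k a * J i b * J j q * dH a b q)"
    using rotate[of "\<lambda>p q m. J i p * J j q * (J k m * dH m p q)"]
    by (simp add: sum_distrib_left ac_simps)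
  have "cov2 (\<Gamma> c) (h c) x k i j =
      (\<Sum>a\<in>UNIV. \<Sum>b\<in>UNIV. \<Sum>q\<in>UNIV. J k a * J i b * J j q * dH a b q)
      - (\<Sum>a\<in>UNIV. \<Sum>b\<in>UNIV. \<Sum>q\<in>UNIV. J k a * J i b * J j q * (\<Sum>p\<in>UNIV. G a b p * H p q))
      - (\<Sum>a\<in>UNIV. \<Sum>b\<in>UNIV. \<Sum>q\<in>UNIV. J k a * J i b * J j q * (\<Sum>p\<in>UNIV. G a q p * H b p))"
    unfolding cov2_def deriv slot1 slot slot2 slot3 by (simp add: hs[of i])
  then show ?thesis
    unfolding cov2_def J_def[symmetric] H_def[symmetric] G_def[symmetric] dH_def[symmetric]
    by (simp add: right_diff_distrib sum_subtractf)
qed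

lemma cubic_form_symmetric3_field:
  assumes A: "smooth_atlas A" and st: "statistical_structure A \<Gamma> h"
  shows "symmetric3_field A (cubic_form \<Gamma> h)"
proof -
  have h: "metric_field A h" and \<Gamma>: "affine_connection A \<Gamma>"
    using st by (simp_all add: statistical_structure_def)
  have "smooth_on (coords c) (\<lambda>x. cubic_form \<Gamma> h c x i j k)" if c: "c \<in> A" for c i j k
  proof -
    have S: "open (coords c)" using A c by (auto simp: smooth_atlas_def)
    have sh: "smooth_on (coords c) (\<lambda>x. h c x i j)" for i j
      using h c unfolding metric_field_def by blast
    have s\<Gamma>: "smooth_on (coords c) (\<lambda>x. \<Gamma> c x i j k)" for i j k
      using \<Gamma> c unfolding affine_connection_def by blast
    show ?thesis
      unfolding cubic_form_def cov2_def
      by (intro smooth_on_diff smooth_on_sum smooth_on_mult smooth_on_pd sh s\<Gamma> S finite)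
  qed
  moreover have "cubic_form \<Gamma> h c x i j k = cubic_form \<Gamma> h c x j i k \<and>
      cubic_form \<Gamma> h c x i j k = cubic_form \<Gamma> h c x i k j" if c: "c \<in> A" and x: "x \<in> coords c" for c x i j k
  proof
    have S: "open (coords c)" using A c by (auto simp: smooth_atlas_def)
    have hs: "h c y p q = h c y q p" if "y \<in> coords c" for y p q
      using h c that unfolding metric_field_def by blast
    have "pd i (\<lambda>y. h c y j k) x = pd i (\<lambda>y. h c y k j) x"
      by (rule pd_cong[OF S x hs])
    then show "cubic_form \<Gamma> h c x i j k = cubic_form \<Gamma> h c x i k j"
      by (simp add: cubic_form_def cov2_def hs[OF x, of _ k] hs[OF x, of _ j])
    show "cubic_form \<Gamma> h c x i j k = cubic_form \<Gamma> h c x j i k"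
      using st c x unfolding statistical_structure_def cubic_form_def by blast
  qed
  moreover have "cubic_form \<Gamma> h c x i j k = (\<Sum>p\<in>UNIV. \<Sum>q\<in>UNIV. \<Sum>r\<in>UNIV.
      jac c d x i p * jac c d x j q * jac c d x k r * cubic_form \<Gamma> h d (transition c d x) p q r)"
    if "c \<in> A" "d \<in> A" "x \<in> overlap c d" for c d x i j k
    unfolding cubic_form_def by (rule cov2_metric_transform[OF A that(1,2) h \<Gamma> that(3)])
  ultimately show ?thesis unfolding symmetric3_field_def by blast
qed

text \<open>The lowered coefficients follow as in the Koszul formula: in \<open>L\<^sub>i\<^sub>j\<^sub>l + L\<^sub>j\<^sub>i\<^sub>l - L\<^sub>l\<^sub>i\<^sub>j\<close> the derivatives of \<open>h\<close>
  add up to \<open>2 C\<^sub>i\<^sub>j\<^sub>l\<close> and the connection terms to \<open>-2 G\<^sub>i\<^sub>j\<^sub>l\<close>, while the sum itself is \<open>L\<^sub>i\<^sub>j\<^sub>l\<close> because \<open>L\<close> is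
  symmetric. Tracelessness is \<open>\<nabla> det h = 0\<close> divided by \<open>det h\<close>.\<close>

lemma statistical_chart_of_special:
  assumes A: "smooth_atlas A" and sp: "special_statistical_structure A \<Gamma> h" and c: "c \<in> A"
  shows "statistical_chart (coords c) (h c) (cubic_form \<Gamma> h c) (\<Gamma> c) (conjugate \<Gamma> h c)"
proof -
  have st: "statistical_structure A \<Gamma> h"
    and det: "\<And>x i. x \<in> coords c \<Longrightarrow> cov_det (\<Gamma> c) (h c) x i = 0"
    using sp c by (simp_all add: special_statistical_structure_def)
  have h: "metric_field A h" using st by (simp add: statistical_structure_def)
  have sym\<Gamma>: "\<Gamma> c x i j k = \<Gamma> c x j i k" if "x \<in> coords c" for x i j k
    using st c that unfolding statistical_structure_def torsion_free_def by blast
  interpret metric_chart "coords c" "h c"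
    using A h c by unfold_locales (auto simp: smooth_atlas_def metric_field_def)
  interpret cubic_chart "coords c" "h c" "cubic_form \<Gamma> h c"
    using cubic_form_symmetric3_field[OF A st] c
    by unfold_locales (auto simp: symmetric3_field_def)
  let ?L = "cubic_form \<Gamma> h c"
  have lower: "(\<Sum>p\<in>UNIV. \<Gamma> c x i j p * h c x p l) = christoffel1 (h c) x i j l + (- (1 / 2)) * ?L x i j l"
    if x: "x \<in> coords c" for x i j l
  proof -
    define G where "G i j l = (\<Sum>p\<in>UNIV. \<Gamma> c x i j p * h c x p l)" for i j l
    have L: "?L x i j k = pd i (\<lambda>y. h c y j k) x - G i j k - G i k j" for i j k
      by (simp add: cubic_form_def cov2_def G_def sym_h[OF x, of j])
    have Gs: "G i j k = G j i k" for i j k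
      unfolding G_def using sym\<Gamma>[OF x] by simp
    have Ls: "?L x j i l = ?L x i j l" "?L x l i j = ?L x i j l"
      using sym_\<omega>[OF x] by metis+
    show ?thesis
      using L[of i j l] L[of j i l] L[of l i j] Gs[of i j l] Gs[of i l j] Gs[of j l i] Ls
      unfolding G_def[symmetric] christoffel1_def by (simp add: field_simps)
  qed
  have lower': "(\<Sum>p\<in>UNIV. conjugate \<Gamma> h c x i j p * h c x p l) =
      christoffel1 (h c) x i j l + 1 / 2 * ?L x i j l" if x: "x \<in> coords c" for x i j l
    using lower[OF x, of i j l] lower_raise[OF x, of "cov2 (\<Gamma> c) (h c) x i j" l]
    by (simp add: conjugate_def distrib_right sum.distrib cubic_form_def)
  have tracefree: "(\<Sum>j\<in>UNIV. \<Sum>k\<in>UNIV. ginv (h c) x j k * ?L x i j k) = 0"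
    if x: "x \<in> coords c" for x i
  proof -
    have "det_h (h c) x \<noteq> 0"
      using nondeg[OF x] by (simp add: det_h_def invertible_det_nz)
    moreover have "0 = det_h (h c) x * (\<Sum>j\<in>UNIV. \<Sum>k\<in>UNIV. ginv (h c) x j k * ?L x i j k)"
      unfolding det[OF x, of i, symmetric] cubic_form_def
      by (rule cov_det_eq[OF nondeg[OF x] sym_h[OF x] smooth_on_differentiable[OF smooth_h x]])
    ultimately show ?thesis by simp
  qed
  show ?thesis by unfold_locales (use lower lower' tracefree in auto)
qed

section \<open>Curvature conditions and the coupled equations\<close>

theorem theorem4p9:
  fixes A :: "('m::{t2_space,second_countable_topology}, 'n::finite) chart set"
    and nabla :: "('m, 'n) chart \<Rightarrow> 'n tensor3"
    and h :: "('m, 'n) chart \<Rightarrow> 'n tensor2"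
  assumes "CARD('n) \<ge> 2"
    and "smooth_atlas A"
    and "special_statistical_structure A nabla h"
  shows "(constant_curvature A nabla h \<longleftrightarrow>
            (\<exists>\<kappa>. scalar_curvature_is A nabla h \<kappa> \<and>
                 coupled_projectively_flat A h (cubic_form nabla h) (1 / 4) \<kappa>)) \<and>
         (self_conjugate_curvature A nabla h \<and> einstein A nabla h \<longleftrightarrow>
            (\<exists>\<kappa>. scalar_curvature_is A nabla h \<kappa> \<and>
                 coupled_einstein A h (cubic_form nabla h) (1 / 4) \<kappa>)) \<and>
         (self_conjugate_curvature A nabla h \<and> constant_scalar_curvature A nabla h \<longleftrightarrow>
            (\<exists>\<kappa>. scalar_curvature_is A nabla h \<kappa> \<and>
                 coupled_constraint A h (cubic_form nabla h) (1 / 4) \<kappa>))"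
proof -
  let ?L = "cubic_form nabla h" and ?n = "real CARD('n)"
  have st: "statistical_structure A nabla h" and metric: "metric_field A h"
    using assms(3) by (simp_all add: special_statistical_structure_def statistical_structure_def)
  note chart = statistical_chart_of_special[OF assms(2,3)]
  have n: "?n \<noteq> 0" "?n - 1 \<noteq> 0" using assms(1) by auto
  have codazzi: "tracefree_codazzi A h ?L \<longleftrightarrow>
      (\<forall>c\<in>A. \<forall>x\<in>coords c. \<forall>i j k l. cubic_chart.codazzi (h c) (?L c) x i j k l = 0)"
  proof -
    have "cubic_chart.codazzi (h c) (?L c) x i j k l =
        cov3 (levi_civita (h c)) (?L c) x i j k l - cov3 (levi_civita (h c)) (?L c) x j i k l"
      if "c \<in> A" for c x i j k l
    proof -
      interpret statistical_chart "coords c" "h c" "?L c" "nabla c" "conjugate nabla h c"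
        by (rule chart[OF that])
      show ?thesis by (rule codazzi_def)
    qed
    then show ?thesis
      using cubic_form_symmetric3_field[OF assms(2) st] statistical_chart.tracefree[OF chart]
      unfolding tracefree_codazzi_def by auto
  qed
  have self_conj: "self_conjugate_curvature A nabla h \<longleftrightarrow> tracefree_codazzi A h ?L"
    unfolding self_conjugate_curvature_def codazzi
    using statistical_chart.self_conjugate_iff_codazzi[OF chart] by simp
  have scalar: "scalar_curvature (nabla c) (h c) x = scal (h c) x - 1 / 4 * norm2 (h c) (?L c) x"
    if "c \<in> A" "x \<in> coords c" for c x
    using statistical_chart.scalar_curvature_eq[OF chart] that by blast
  have flat: "constant_curvature A nabla h \<longleftrightarrow> (\<exists>\<kappa>. scalar_curvature_is A nabla h \<kappa> \<and>
      coupled_projectively_flat A h ?L (1 / 4) \<kappa>)"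
  proof
    assume "constant_curvature A nabla h"
    then obtain \<alpha> where const: "\<And>c x. c \<in> A \<Longrightarrow> x \<in> coords c \<Longrightarrow>
        \<forall>i j k l. lower_last (h c) (curvature (nabla c)) x i j k l = \<alpha> * kn2 (h c) x i j k l"
      unfolding constant_curvature_def by blast
    note at = statistical_chart.constant_curvature_at[OF chart _ const]
    let ?\<kappa> = "- (?n * (?n - 1)) * \<alpha>"
    have "scalar_curvature_is A nabla h ?\<kappa>"
      unfolding scalar_curvature_is_def using at(2) by blast
    moreover have "tracefree_codazzi A h ?L" unfolding codazzi using at(1) by blast
    moreover have "Riem (h c) x i j k l - 1 / 4 * kn3 (h c) (?L c) x i j k l =
        - (?\<kappa> / (?n * (?n - 1))) * kn2 (h c) x i j k l" if c: "c \<in> A" "x \<in> coords c" for c x i j k l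
    proof -
      have "- (?\<kappa> / (?n * (?n - 1))) = \<alpha>" using n by simp
      then show ?thesis
        using const[OF c] at(1)[OF c(1,2,1,2)] statistical_chart.curvature_lower(1)[OF chart[OF c(1)] c(2)]
        by simp
    qed
    ultimately show "\<exists>\<kappa>. scalar_curvature_is A nabla h \<kappa> \<and> coupled_projectively_flat A h ?L (1 / 4) \<kappa>"
      using metric unfolding coupled_projectively_flat_def by blast
  next
    assume "\<exists>\<kappa>. scalar_curvature_is A nabla h \<kappa> \<and> coupled_projectively_flat A h ?L (1 / 4) \<kappa>"
    then obtain \<kappa> where "coupled_projectively_flat A h ?L (1 / 4) \<kappa>" by blast
    then have cod: "tracefree_codazzi A h ?L" and eq: "\<And>c x i j k l. c \<in> A \<Longrightarrow> x \<in> coords c \<Longrightarrow>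
        Riem (h c) x i j k l - 1 / 4 * kn3 (h c) (?L c) x i j k l =
        - (\<kappa> / (?n * (?n - 1))) * kn2 (h c) x i j k l"
      unfolding coupled_projectively_flat_def by blast+
    have "lower_last (h c) (curvature (nabla c)) x i j k l =
        - (\<kappa> / (?n * (?n - 1))) * kn2 (h c) x i j k l" if c: "c \<in> A" "x \<in> coords c" for c x i j k l
      using statistical_chart.curvature_lower(1)[OF chart[OF c(1)] c(2), of i j k l] eq[OF c, of i j k l]
        cod[unfolded codazzi] c by simp
    then show "constant_curvature A nabla h" unfolding constant_curvature_def by blast
  qed
  \<comment> \<open>both sides entail that \<open>L\<close> is Codazzi, and then \<open>\<rho>\<close> of the conjugate curvature is that of \<open>R\<close>\<close>
  have einst: "self_conjugate_curvature A nabla h \<and> einstein A nabla h \<longleftrightarrow>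
      (\<exists>\<kappa>. scalar_curvature_is A nabla h \<kappa> \<and> coupled_einstein A h ?L (1 / 4) \<kappa>)"
  proof (cases "tracefree_codazzi A h ?L")
    case cod: True
    have conj: "rho (curvature (conjugate nabla h c)) x i j = rho (curvature (nabla c)) x i j"
      if "c \<in> A" "x \<in> coords c" for c x i j
      using cod[folded self_conj] that unfolding self_conjugate_curvature_def rho_def by simp
    have at: "(\<exists>f. \<forall>i j. rho (curvature (nabla c)) x i j = f * h c x i j) \<longleftrightarrow>
        (\<forall>i j. Ric (h c) x i j - 1 / 2 * scal (h c) x * h c x i j
          + (?n - 2) / (2 * ?n) * \<kappa> * h c x i j =
        1 / 4 * (rho (raise_last (h c) (kn3 (h c) (?L c))) x i j
               - 1 / 2 * norm2 (h c) (?L c) x * h c x i j))"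
      if "scalar_curvature_is A nabla h \<kappa>" and c: "c \<in> A" "x \<in> coords c" for c x \<kappa>
    proof -
      have \<kappa>: "scalar_curvature (nabla c) (h c) x = \<kappa>"
        using that unfolding scalar_curvature_is_def by blast
      have "\<forall>i j k l. cubic_chart.codazzi (h c) (?L c) x i j k l = 0"
        using cod[unfolded codazzi] c by blast
      from statistical_chart.einstein_at_iff[OF chart[OF c(1)] c(2) this]
      show ?thesis unfolding \<kappa> .
    qed
    have "einstein A nabla h \<longleftrightarrow> (\<exists>\<kappa>. scalar_curvature_is A nabla h \<kappa> \<and>
        (\<forall>c\<in>A. \<forall>x\<in>coords c. \<exists>f. \<forall>i j. rho (curvature (nabla c)) x i j = f * h c x i j))"
      unfolding einstein_def constant_scalar_curvature_def by (simp add: conj cong: ball_cong) blast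
    also have "\<dots> \<longleftrightarrow> (\<exists>\<kappa>. scalar_curvature_is A nabla h \<kappa> \<and> coupled_einstein A h ?L (1 / 4) \<kappa>)"
      unfolding coupled_einstein_def
      by (intro iff_exI conj_cong refl) (simp add: metric cod at cong: ball_cong)
    finally show ?thesis using cod by (simp add: self_conj)
  qed (simp add: self_conj coupled_einstein_def)
  have constr: "self_conjugate_curvature A nabla h \<and> constant_scalar_curvature A nabla h \<longleftrightarrow>
      (\<exists>\<kappa>. scalar_curvature_is A nabla h \<kappa> \<and> coupled_constraint A h ?L (1 / 4) \<kappa>)"
  proof -
    have "coupled_constraint A h ?L (1 / 4) \<kappa> \<longleftrightarrow> tracefree_codazzi A h ?L"
      if \<kappa>: "scalar_curvature_is A nabla h \<kappa>" for \<kappa>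
    proof -
      have const: "scal (h c) x - 1 / 4 * norm2 (h c) (?L c) x = \<kappa>" if "c \<in> A" "x \<in> coords c" for c x
        using \<kappa> scalar[OF that] that by (simp add: scalar_curvature_is_def)
      have "pd i (\<lambda>y. scal (h c) y - 1 / 4 * norm2 (h c) (?L c) y) x = 0"
        if c: "c \<in> A" and x: "x \<in> coords c" for c x i
      proof -
        have "open (coords c)" using assms(2) c by (auto simp: smooth_atlas_def)
        then have "pd i (\<lambda>y. scal (h c) y - 1 / 4 * norm2 (h c) (?L c) y) x = pd i (\<lambda>y. \<kappa>) x"
          by (rule pd_cong[OF _ x const[OF c]])
        then show ?thesis by simp
      qed
      then show ?thesis using metric const unfolding coupled_constraint_def by blast
    qed
    then show ?thesis
      unfolding self_conj constant_scalar_curvature_def by blast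
  qed
  from flat einst constr show ?thesis by blast
qed

end
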